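(* Let $0<q<1$ and $h=\ln q^{-2}$. For every finite function $f\in D(\mathbb U)_q$ in the quantum unit disc, $$\Delta_q^{-1}f=\int_{\mathbb U_q}\mathbb G_1 f\,d\nu,\qquad \Delta_q^{-2}f=\int_{\mathbb U_q}\mathbb G_2 f\,d\nu,$$ where $\mathbb G_1,\mathbb G_2\in D(\mathbb U\times\mathbb U)'_q$ are the kernels $$\mathbb G_1=-\sum_{m=1}^{\infty}\frac{q^{-2}-1}{q^{-2m}-1}\,G_m,$$ $$\mathbb G_2=\sum_{m=1}^{\infty}\frac{q^{2m-2}(1+q^{2m})(1-q^2)^2}{(1-q^{2m})^2}\,G_m-\frac{1-q^2}{h}\sum_{m=1}^{\infty}\frac{q^{-2}-1}{q^{-2m}-1}\,\hat G_m .$$ Here $\Delta_q$ is the $q$-invariant Laplacian regarded as a bounded invertible operator in $L^2(d\nu)_q$, and $G_m$, $\hat G_m$ are the kernels defined in the context.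
   Context: Fix $q\in(0,1)$. Notation: $(a;q^2)_n=\prod_{j=0}^{n-1}(1-aq^{2j})$, $q^{2\mathbb Z_+}=\{q^{2j}:j=0,1,2,\dots\}$. ALGEBRAS. $\mathrm{Pol}(\mathbb C)_q$ is the unital involutive $\mathbb C$-algebra generated by $z$ with the single relation $z^*z=q^2zz^*+1-q^2$. Put $y=1-zz^*$; then $y=y^*$, $z^*y=q^2yz^*$, $zy=q^{-2}yz$, $z^{*k}z^k=(1-q^2y)\cdots(1-q^{2k}y)$, $z^kz^{*k}=(1-y)(1-q^{-2}y)\cdots(1-q^{-2k+2}y)$. $D(\mathbb U)_q$ (finite functions) is the $*$-algebra of finite sums $$f=\sum_{m>0}z^m\psi_m(y)+\psi_0(y)+\sum_{m>0}\psi_{-m}(y)z^{*m}\qquad(\ast)$$ with each $\psi_m:q^{2\mathbb Z_+}\to\mathbb C$ of finite support; products are computed with the relations $z^{*k}z^k=(1-q^2y)\cdots(1-q^{2k}y)$, $z^kz^{*k}=(1-y)(1-q^{-2}y)\cdots(1-q^{-2k+2}y)$ and $z^*\phi(y)=\phi(q^2y)z^*$, $z\phi(y)=\phi(q^{-2}y)z$ (functions are taken to be $0$ off $q^{2\mathbb Z_+}$). $D(\mathbb U)'_q$ is the space of formal series $(\ast)$ with arbitrary functions $\psi_m$ on $q^{2\mathbb Z_+}$; it is a $D(\mathbb U)_q$-bimodule by the same rules. INTEGRAL AND $L^2$. For $f$ as in $(\ast)$, $\nu(f)=\int_{\mathbb U_q}f\,d\nu=(1-q^2)\sum_{m\ge0}\psi_0(q^{2m})q^{-2m}$.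 $L^2(d\nu)_q$ is the completion of $D(\mathbb U)_q$ in the norm $\|f\|=(\int_{\mathbb U_q}f^*f\,d\nu)^{1/2}$; it is identified with a subspace of $D(\mathbb U)'_q$ via the expansion $(\ast)$. LAPLACIAN. The first-order differential calculus over $\mathrm{Pol}(\mathbb C)_q$ is the bimodule generated by $dz,dz^*$ with $z\,dz=q^{-2}dz\,z$, $z^*dz^*=q^2dz^*z^*$, $z^*dz=q^2dz\,z^*$, $z\,dz^*=q^{-2}dz^*z$, with $d$ satisfying the Leibniz rule and $d:z\mapsto dz$, $z^*\mapsto dz^*$; partial derivatives are defined by $df=dz\,\frac{\partial f}{\partial z}+dz^*\,\frac{\partial f}{\partial z^*}$. These extend to $D(\mathbb U)_q$ using $\psi(y)dz=dz\,\psi(y)$, $\psi(y)dz^*=dz^*\psi(y)$ and $d\psi(y)=-dz\,(B\psi)(y)z^*-q^{-2}dz^*\,z(B\psi)(y)$, where $(B\psi)(y)=\frac{\psi(y)-\psi(q^2y)}{y-q^2y}$. Explicitly, for $m\ge0$: $\frac{\partial}{\partial z}(z^m\psi)=\frac{1-q^{-2m}}{1-q^{-2}}z^{m-1}\psi-q^{-2m}z^m(B\psi)z^*$, $\frac{\partial}{\partial z^*}(z^m\psi)=-q^{-2m-2}z^{m+1}(B\psi)$, $\frac{\partial}{\partial z}(\psi z^{*m})=-(B\psi)z^{*(m+1)}$, $\frac{\partial}{\partial z^*}(\psi z^{*m})=-q^{-2}z(B\psi)z^{*m}+\frac{1-q^{2m}}{1-q^2}\psi z^{*(m-1)}$ (for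 $m=0$ the terms with zero coefficient are omitted). The $q$-invariant Laplacian is $\Delta_qf=(1-zz^* )^2\frac{\partial}{\partial z^*}\frac{\partial}{\partial z}f$. It is known that $\Delta_q$ extends from $D(\mathbb U)_q$ to a bounded selfadjoint invertible operator in $L^2(d\nu)_q$; $\Delta_q^{-1},\Delta_q^{-2}$ refer to this extension. KERNELS. Write $z,y,z^*$ for $z\otimes1,y\otimes1,z^*\otimes1$ and $\zeta,\eta,\zeta^*$ for $1\otimes z,1\otimes y,1\otimes z^*$. $D(\mathbb U\times\mathbb U)'_q$ is the space of formal series $\sum_{(i,j)\in\mathbb Z^2}f_{ij}$, where $f_{ij}$ is given by an arbitrary function $\psi_{ij}$ on $q^{2\mathbb Z_+}\times q^{2\mathbb Z_+}$: $f_{ij}=z^i\zeta^j\psi_{ij}(y,\eta)$ for $i,j\ge0$; $z^i\psi_{ij}(y,\eta)\zeta^{*|j|}$ for $i\ge0>j$; $\zeta^j\psi_{ij}(y,\eta)z^{*|i|}$ for $i<0\le j$; $\psi_{ij}(y,\eta)z^{*|i|}\zeta^{*|j|}$ for $i,j<0$. Its topology is that of pointwise convergence of all coefficient functions $\psi_{ij}$. For $K\in D(\mathbb U\times\mathbb U)'_q$ and $f\in D(\mathbb U)_q$, $\int_{\mathbb U_q}Kf\,d\nu:=(\mathrm{id}\otimes\nu)(K\cdot(1\otimes f))\in D(\mathbb U)'_q$. For $l\in\mathbb C$, $$G_l=\sum_{k,n\ge0}q^{2k}\frac{(q^{2l};q^2)_k(q^{2l};q^2)_n}{(q^2;q^2)_k(q^2;q^2)_n}\,z^ny^lz^{*k}\,\zeta^k\eta^l\zeta^{*n}\in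 D(\mathbb U\times\mathbb U)'_q ,$$ where $y^l$ is the function $q^{2j}\mapsto q^{2jl}$; here $z^ny^lz^{*k}$ is put in normal form using $z^ky^lz^{*k}=(q^{-2k}y)^l(1-y)(1-q^{-2}y)\cdots(1-q^{-2k+2}y)$, and similarly for $\zeta^k\eta^l\zeta^{*n}$, so every coefficient value is a finite sum (a Laurent polynomial in $q^{-2l}$). For $N=1,2,\dots$, $\hat G_N=\lim_{l\to N}\frac{G_l-G_N}{l-N}$ in the topology of $D(\mathbb U\times\mathbb U)'_q$, i.e. pointwise convergence of all coefficient functions $\psi_{ij}$ on $q^{2\mathbb Z_+}\times q^{2\mathbb Z_+}$. The infinite sums over $m$ in the claim also converge in this topology of pointwise convergence of all coefficient functions. *)

theory Defs
  imports "HOL-Analysis.Analysis"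
begin

text \<open>
  A formal series
  \<open>\<Sum>m>0. z^m \<psi>_m(y) + \<psi>_0(y) + \<Sum>m>0. \<psi>_{-m}(y) z*^m\<close> of \<open>D(U)'_q\<close>
  is represented by its coefficient functions: \<open>f m j\<close> is the value of \<open>\<psi>_m\<close> at \<open>y = q^(2j)\<close>.
  Likewise \<open>K i j a b\<close> is the value of \<open>\<psi>_{ij}\<close> at \<open>(y, \<eta>) = (q^(2a), q^(2b))\<close>
  for a kernel \<open>K\<close> of \<open>D(U \<times> U)'_q\<close>.  Functions on \<open>q^(2 Z_+)\<close> are functions on \<open>nat\<close>;
  \<open>\<phi>(q^2 y)\<close> is a shift of the argument.
  All sums over \<open>int\<close> or pairs written with \<open>infsum\<close> below have only finitely many nonzero terms
  in the situations in which they are used.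
\<close>

type_synonym disc_series = "int \<Rightarrow> nat \<Rightarrow> complex"
type_synonym disc_kernel = "int \<Rightarrow> int \<Rightarrow> nat \<Rightarrow> nat \<Rightarrow> complex"

definition finite_fun :: "disc_series \<Rightarrow> bool" where
  "finite_fun f \<longleftrightarrow> finite {(m, j). f m j \<noteq> 0}"

text \<open>
  Normal form of \<open>z^a \<phi>(y) z*^b\<close>: with \<open>c = min a b\<close>,
  \<open>z^c \<phi>(y) z*^c = \<phi>(q^(-2c) y) (1 - y) (1 - q^(-2) y) \<dots> (1 - q^(-2c+2) y)\<close>,
  where \<open>\<phi>\<close> is taken to be 0 off \<open>q^(2 Z_+)\<close>.
\<close>

definition word :: "real \<Rightarrow> nat \<Rightarrow> (nat \<Rightarrow> complex) \<Rightarrow> nat \<Rightarrow> disc_series" where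
  "word q a \<phi> b = (\<lambda>k j.
     if k = int a - int b
     then (let c = min a b in
             (if c \<le> j then \<phi> (j - c) else 0) *
             complex_of_real (\<Prod>i<c. 1 - q ^ (2 * j) / q ^ (2 * i)))
     else 0)"

text \<open>
  Product of two words in normal form, \<open>z^a \<phi>(y) z*^b \<cdot> z^c \<psi>(y) z*^d\<close>.
  With \<open>t = min b c\<close>, \<open>u = b - t\<close>, \<open>v = c - t\<close> (one of \<open>u\<close>, \<open>v\<close> is 0) and
  \<open>P_t(y) = (1 - q^2 y) \<dots> (1 - q^(2t) y) = z*^t z^t\<close> it equals
  \<open>z^a \<phi>(y) z*^u P_t(y) z^v \<psi>(y) z*^d
    = z^(a+v) \<phi>(q^(2v) y) P_t(q^(2(u+v)) y) \<psi>(q^(2u) y) z*^(u+d)\<close>.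
\<close>

definition word_mult ::
  "real \<Rightarrow> nat \<Rightarrow> (nat \<Rightarrow> complex) \<Rightarrow> nat \<Rightarrow> nat \<Rightarrow> (nat \<Rightarrow> complex) \<Rightarrow> nat \<Rightarrow> disc_series" where
  "word_mult q a \<phi> b c \<psi> d =
     (let t = min b c; u = b - t; v = c - t in
        word q (a + v)
          (\<lambda>j. \<phi> (j + v) * complex_of_real (\<Prod>i=1..t. 1 - q ^ (2 * (i + u + v + j))) * \<psi> (j + u))
          (u + d))"

text \<open>
  The component of index \<open>m\<close> is the word \<open>z^a \<psi>_m(y) z*^b\<close> with \<open>a = nat m\<close>, \<open>b = nat (- m)\<close>.
  The product is meaningful when one of the factors has finite support, or when both have
  finitely many nonzero components.
\<close>

definition disc_mult :: "real \<Rightarrow> disc_series \<Rightarrow> disc_series \<Rightarrow> disc_series" where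
  "disc_mult q f g = (\<lambda>k j. infsum (\<lambda>(m, n).
     word_mult q (nat m) (f m) (nat (- m)) (nat n) (g n) (nat (- n)) k j) UNIV)"

definition disc_star :: "disc_series \<Rightarrow> disc_series" where
  "disc_star f = (\<lambda>m j. cnj (f (- m) j))"

definition disc_integral :: "real \<Rightarrow> disc_series \<Rightarrow> complex" where
  "disc_integral q f =
     complex_of_real (1 - q\<^sup>2) * (\<Sum>m. f 0 m / complex_of_real (q ^ (2 * m)))"

definition disc_norm :: "real \<Rightarrow> disc_series \<Rightarrow> real" where
  "disc_norm q f = sqrt (Re (disc_integral q (disc_mult q (disc_star f) f)))"

text \<open>
  An element of the completion, given by a Cauchy sequence of finite functions, is identified with
  the formal series to which the sequence converges coefficientwise.
\<close>

definition L2_approx :: "real \<Rightarrow> (nat \<Rightarrow> disc_series) \<Rightarrow> disc_series \<Rightarrow> bool" where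
  "L2_approx q s F \<longleftrightarrow>
     (\<forall>n. finite_fun (s n)) \<and>
     (\<forall>e>0. \<exists>N. \<forall>m\<ge>N. \<forall>n\<ge>N. disc_norm q (\<lambda>k j. s m k j - s n k j) < e) \<and>
     (\<forall>k j. (\<lambda>n. s n k j) \<longlonglongrightarrow> F k j)"

definition disc_L2 :: "real \<Rightarrow> disc_series set" where
  "disc_L2 q = {F. \<exists>s. L2_approx q s F}"

definition qdiff :: "real \<Rightarrow> (nat \<Rightarrow> complex) \<Rightarrow> nat \<Rightarrow> complex" where
  "qdiff q \<psi> = (\<lambda>j. (\<psi> j - \<psi> (Suc j)) / complex_of_real (q ^ (2 * j) - q\<^sup>2 * q ^ (2 * j)))"

text \<open>
  Partial derivatives of \<open>z^n \<psi>(y)\<close> (suffix \<open>pos\<close>) and of \<open>\<psi>(y) z*^n\<close> (suffix \<open>neg\<close>).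
  For \<open>n = 0\<close> the terms containing \<open>n - 1\<close> have coefficient 0.
\<close>

definition dz_pos :: "real \<Rightarrow> nat \<Rightarrow> (nat \<Rightarrow> complex) \<Rightarrow> disc_series" where
  "dz_pos q n \<psi> = (\<lambda>k j.
     complex_of_real ((1 - 1 / q ^ (2 * n)) / (1 - 1 / q\<^sup>2)) * word q (n - 1) \<psi> 0 k j
     - complex_of_real (1 / q ^ (2 * n)) * word q n (qdiff q \<psi>) 1 k j)"

definition dz_neg :: "real \<Rightarrow> nat \<Rightarrow> (nat \<Rightarrow> complex) \<Rightarrow> disc_series" where
  "dz_neg q n \<psi> = (\<lambda>k j. - word q 0 (qdiff q \<psi>) (n + 1) k j)"

definition dzstar_pos :: "real \<Rightarrow> nat \<Rightarrow> (nat \<Rightarrow> complex) \<Rightarrow> disc_series" where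
  "dzstar_pos q n \<psi> = (\<lambda>k j.
     - complex_of_real (1 / q ^ (2 * n + 2)) * word q (n + 1) (qdiff q \<psi>) 0 k j)"

definition dzstar_neg :: "real \<Rightarrow> nat \<Rightarrow> (nat \<Rightarrow> complex) \<Rightarrow> disc_series" where
  "dzstar_neg q n \<psi> = (\<lambda>k j.
     - complex_of_real (1 / q\<^sup>2) * word q 1 (qdiff q \<psi>) n k j
     + complex_of_real ((1 - q ^ (2 * n)) / (1 - q\<^sup>2)) * word q 0 \<psi> (n - 1) k j)"

definition disc_dz :: "real \<Rightarrow> disc_series \<Rightarrow> disc_series" where
  "disc_dz q f = (\<lambda>k j. infsum (\<lambda>m.
     (if 0 \<le> m then dz_pos q (nat m) (f m) else dz_neg q (nat (- m)) (f m)) k j) UNIV)"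

definition disc_dzstar :: "real \<Rightarrow> disc_series \<Rightarrow> disc_series" where
  "disc_dzstar q f = (\<lambda>k j. infsum (\<lambda>m.
     (if 0 \<le> m then dzstar_pos q (nat m) (f m) else dzstar_neg q (nat (- m)) (f m)) k j) UNIV)"

text \<open>The series \<open>y = 1 - z z*\<close>.\<close>

definition disc_y :: "real \<Rightarrow> disc_series" where
  "disc_y q = word q 0 (\<lambda>j. complex_of_real (q ^ (2 * j))) 0"

definition laplacian :: "real \<Rightarrow> disc_series \<Rightarrow> disc_series" where
  "laplacian q f = disc_mult q (disc_mult q (disc_y q) (disc_y q)) (disc_dzstar q (disc_dz q f))"

text \<open>The extension of \<open>laplacian q\<close> from finite functions to \<open>disc_L2 q\<close> by continuity.\<close>

definition laplacian_L2 :: "real \<Rightarrow> disc_series \<Rightarrow> disc_series" where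
  "laplacian_L2 q F =
     (THE H. \<exists>s. L2_approx q s F \<and> L2_approx q (\<lambda>n. laplacian q (s n)) H)"

definition laplacian_inv :: "real \<Rightarrow> disc_series \<Rightarrow> disc_series" where
  "laplacian_inv q = the_inv_into (disc_L2 q) (laplacian_L2 q)"

text \<open>\<open>K \<cdot> (1 \<otimes> f)\<close>: the factor \<open>1 \<otimes> f\<close> acts on the second tensor leg only.\<close>

definition kernel_mult_right :: "real \<Rightarrow> disc_kernel \<Rightarrow> disc_series \<Rightarrow> disc_kernel" where
  "kernel_mult_right q K f = (\<lambda>i j a b. disc_mult q (\<lambda>j' b'. K i j' a b') f j b)"

definition kernel_integral :: "real \<Rightarrow> disc_kernel \<Rightarrow> disc_series \<Rightarrow> disc_series" where
  "kernel_integral q K f =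
     (\<lambda>i a. disc_integral q (\<lambda>j b. kernel_mult_right q K f i j a b))"

definition tensor :: "disc_series \<Rightarrow> disc_series \<Rightarrow> disc_kernel" where
  "tensor F H = (\<lambda>i j a b. F i a * H j b)"

definition qpoch :: "real \<Rightarrow> complex \<Rightarrow> nat \<Rightarrow> complex" where
  "qpoch q a n = (\<Prod>j<n. 1 - a * complex_of_real (q ^ (2 * j)))"

definition ypow :: "real \<Rightarrow> complex \<Rightarrow> nat \<Rightarrow> complex" where
  "ypow q l = (\<lambda>j. complex_of_real q powr (2 * of_nat j * l))"

definition kernel_G :: "real \<Rightarrow> complex \<Rightarrow> disc_kernel" where
  "kernel_G q l = (\<lambda>i j a b. infsum (\<lambda>(k, n).
     complex_of_real (q ^ (2 * k)) *
     (qpoch q (complex_of_real q powr (2 * l)) k * qpoch q (complex_of_real q powr (2 * l)) n) /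
     (qpoch q (complex_of_real (q\<^sup>2)) k * qpoch q (complex_of_real (q\<^sup>2)) n) *
     tensor (word q n (ypow q l) k) (word q k (ypow q l) n) i j a b) UNIV)"

definition kernel_G_hat :: "real \<Rightarrow> nat \<Rightarrow> disc_kernel" where
  "kernel_G_hat q N = (\<lambda>i j a b.
     Lim (at (of_nat N)) (\<lambda>l. (kernel_G q l i j a b - kernel_G q (of_nat N) i j a b) / (l - of_nat N)))"

definition kernel_scale :: "real \<Rightarrow> disc_kernel \<Rightarrow> disc_kernel" where
  "kernel_scale c K = (\<lambda>i j a b. complex_of_real c * K i j a b)"

text \<open>The series \<open>X 1 + X 2 + \<dots>\<close> in the topology of coefficientwise convergence.\<close>

definition kernel_summable :: "(nat \<Rightarrow> disc_kernel) \<Rightarrow> bool" where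
  "kernel_summable X \<longleftrightarrow> (\<forall>i j a b. summable (\<lambda>m. X (Suc m) i j a b))"

definition kernel_suminf :: "(nat \<Rightarrow> disc_kernel) \<Rightarrow> disc_kernel" where
  "kernel_suminf X = (\<lambda>i j a b. \<Sum>m. X (Suc m) i j a b)"

definition green1_term :: "real \<Rightarrow> nat \<Rightarrow> disc_kernel" where
  "green1_term q m =
     kernel_scale ((1 / q\<^sup>2 - 1) / (1 / q ^ (2 * m) - 1)) (kernel_G q (of_nat m))"

definition green2_term :: "real \<Rightarrow> nat \<Rightarrow> disc_kernel" where
  "green2_term q m =
     kernel_scale (q ^ (2 * m - 2) * (1 + q ^ (2 * m)) * (1 - q\<^sup>2)\<^sup>2 / (1 - q ^ (2 * m))\<^sup>2)
       (kernel_G q (of_nat m))"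

definition green2_hat_term :: "real \<Rightarrow> nat \<Rightarrow> disc_kernel" where
  "green2_hat_term q m =
     kernel_scale ((1 / q\<^sup>2 - 1) / (1 / q ^ (2 * m) - 1)) (kernel_G_hat q m)"

definition green1 :: "real \<Rightarrow> disc_kernel" where
  "green1 q = (\<lambda>i j a b. - kernel_suminf (green1_term q) i j a b)"

definition green2 :: "real \<Rightarrow> disc_kernel" where
  "green2 q = (let h = ln (1 / q\<^sup>2) in
     (\<lambda>i j a b. kernel_suminf (green2_term q) i j a b
        - kernel_scale ((1 - q\<^sup>2) / h) (kernel_suminf (green2_hat_term q)) i j a b))"

end

theory Submission
  imports Defs "HOL-Computational_Algebra.Polynomial"
begin

text \<open>
  Write \<open>p = q\<^sup>2\<close>, \<open>x = p\<^sup>l\<close> and \<open>D = x d/dx\<close>.  Everything in sight respects the grading by degree, so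
  each claim is a claim about functions on \<open>nat\<close>, one for every degree \<open>i\<close>, and depends on \<open>i\<close>
  through \<open>r = \<bar>i\<bar>\<close> only.  There the Laplacian is the difference operator \<open>L\<close> (\<open>radial\<close>) with
  \<open>(1 - p)\<^sup>2 (L \<psi>)(j) = (1 - p\<^bsup>j+1+r\<^esup>) (\<psi>(j+1) - \<psi>(j)) - p (1 - p\<^sup>j) (\<psi>(j) - \<psi>(j-1))\<close>
  (lemma \<open>laplacian_eq\<close>), and \<open>G\<^sub>l\<close> has the coefficients \<open>g\<^sub>x(a,b)\<close>, up to a power of \<open>p\<close>, where
  \<open>g\<^sub>x(a,b)\<close> is a polynomial in \<open>x\<close> (\<open>invariant_poly\<close>, lemma \<open>kernel_G_eq\<close>).

  The kernels are not eigenfunctions; \<open>L\<close>, applied in the variable \<open>a\<close>, mixes \<open>G\<^sub>l\<close> with \<open>G\<^bsub>l+1\<^esub>\<close>: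
  \<open>(1 - p)\<^sup>2 L g\<^sub>x = ((1 - x) (p - x) / x) g\<^sub>x - (p (1 - x)\<^sup>2 / x) g\<^bsub>px\<^esub>\<close>
  (lemma \<open>radial_invariant_poly\<close>).  With \<open>c(x) = (1 - p)/p \<cdot> x/(1 - x)\<close>, whose values at \<open>x = p\<^sup>m\<close> are,
  up to sign, the coefficients of the first Green kernel, this becomes
  \<open>(1 - p) L (c(x) g\<^sub>x) = (1 - x/p) g\<^sub>x - (1 - x) g\<^bsub>px\<^esub>\<close>,
  a difference of consecutive values of \<open>(1 - x/p) g\<^sub>x\<close> along \<open>x = p, p\<^sup>2, p\<^sup>3, \<dots>\<close>.  The sum
  telescopes.  The first term vanishes because \<open>1 - x/p = 0\<close> at \<open>x = p\<close>, and the limit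
  is \<open>g\<^sub>0(a,b)\<close>, which is the Kronecker delta divided by the density of the integral.  Hence the
  first Green kernel inverts \<open>L\<close>.

  For the second kernel, the derivative of \<open>G\<^sub>l\<close> in \<open>l\<close> at \<open>N\<close> is given by \<open>ln p \<cdot> D g\<^sub>x\<close> at
  \<open>x = p\<^sup>N\<close>, and differentiating the relation above gives one for
  \<open>D g\<^sub>x\<close> (lemma \<open>radial_euler\<close>).  With \<open>d(x) = (1 - p)\<^sup>2/p \<cdot> x (1 + x)/(1 - x)\<^sup>2\<close> the two combine to
  \<open>L (d(x) g\<^sub>x + (1 - p) c(x) D g\<^sub>x) = - c(x) g\<^sub>x + (1 - x/p) D g\<^sub>x - (1 - x) (D g)\<^bsub>px\<^esub>\<close>
  (lemma \<open>radial_green2_term\<close>).  The difference telescopes again, now to \<open>0\<close>, since \<open>D g\<^sub>x\<close> vanishes at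
  \<open>x = 0\<close>; what remains is the first Green kernel.

  It remains to connect this with the operator on the completion.  The norm is a weighted \<open>\<ell>\<^sup>2\<close> norm
  (\<open>disc_norm_eq\<close>) for which \<open>L\<close> is bounded (\<open>laplacian_bounded\<close>), so its extension by continuity is
  the same formal difference operator (\<open>laplacian_L2_eq\<close>).  It is injective, because a solution of
  \<open>L \<psi> = 0\<close> is constant, whereas square integrable series have coefficients tending to \<open>0\<close>
  (\<open>inj_on_laplacian_L2\<close>).  Finally both Green kernels are \<open>O(a p\<^sup>a)\<close> for fixed \<open>b\<close>, so they map finite
  functions to square integrable series (\<open>kernel_integral_disc_L2\<close>), and the formal identities
  identify the images as values of the inverse.
\<close>

section \<open>The Laplacian and the invariant kernels in one degree\<close>

text \<open>The factor \<open>(1 - y) (1 - p\<^sup>-\<^sup>1 y) \<dots> (1 - p\<^bsup>1-c\<^esup> y)\<close> of \<open>z\<^sup>c \<phi>(y) z*\<^sup>c\<close> at the point \<open>y = p\<^sup>a\<close>.  It vanishes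
  for \<open>a < c\<close>, which makes the boundary cases of all later sums automatic.\<close>

definition falling :: "complex \<Rightarrow> nat \<Rightarrow> nat \<Rightarrow> complex" where
  "falling P c a = (\<Prod>t<c. 1 - P ^ a / P ^ t)"

lemma falling_0 [simp]: "falling P 0 a = 1"
  by (simp add: falling_def)

lemma falling_Suc: "falling P (Suc c) a = falling P c a * (1 - P ^ a / P ^ c)"
  by (simp add: falling_def)

lemma falling_Suc_Suc:
  assumes "P \<noteq> 0"
  shows "falling P (Suc c) (Suc a) = (1 - P * P ^ a) * falling P c a"
proof -
  have "falling P (Suc c) (Suc a) = (1 - P * P ^ a) * (\<Prod>t<c. 1 - (P * P ^ a) / (P * P ^ t))"
    unfolding falling_def prod.lessThan_Suc_shift by simp
  also have "(\<lambda>t. 1 - (P * P ^ a) / (P * P ^ t)) = (\<lambda>t. 1 - P ^ a / P ^ t)"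
    using assms by simp
  finally show ?thesis by (simp add: falling_def)
qed

lemma falling_eq_0:
  assumes "P \<noteq> 0" "a < c"
  shows "falling P c a = 0"
  using assms by (auto simp: falling_def)

text \<open>At \<open>j = 0\<close> the value \<open>\<psi> (j - 1)\<close> is multiplied by \<open>1 - P ^ 0 = 0\<close>, so the truncated predecessor
  is harmless.\<close>

definition radial :: "complex \<Rightarrow> nat \<Rightarrow> (nat \<Rightarrow> complex) \<Rightarrow> nat \<Rightarrow> complex" where
  "radial P r \<psi> j = ((1 - P ^ (j + 1 + r)) * (\<psi> (Suc j) - \<psi> j)
      - P * (1 - P ^ j) * (\<psi> j - \<psi> (j - 1))) / (1 - P)\<^sup>2"

lemma radial_numerator:
  assumes "P \<noteq> 1"
  shows "(1 - P)\<^sup>2 * radial P r \<psi> j =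
    (1 - P ^ (j + 1 + r)) * (\<psi> (Suc j) - \<psi> j) - P * (1 - P ^ j) * (\<psi> j - \<psi> (j - 1))"
  using assms by (simp add: radial_def)

text \<open>The functions \<open>x\<^sup>a falling c a\<close>, for \<open>c = 0, 1, 2, \<dots>\<close>, are the values of the first legs
  \<open>z\<^bsup>c+r\<^esup> y\<^sup>l z*\<^sup>c\<close> of \<open>G\<^sub>l\<close> up to the factor \<open>x\<^sup>c\<close>, and \<open>L\<close> is tridiagonal on them.  The diagonal entry is
  written as the value at \<open>y = 0\<close>, where all the polynomials \<open>falling c\<close> equal 1, minus the two
  off-diagonal ones; this is the form in which summation by parts applies.\<close>

lemma radial_power_falling:
  assumes P: "P \<noteq> 0" "P \<noteq> 1" and x: "x \<noteq> 0"
  shows "(1 - P)\<^sup>2 * radial P r (\<lambda>a. x ^ a * falling P c a) a =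
     x ^ a * ((1 - x) * (P - x) / x * falling P c a
       + P / x * (1 - x * P ^ c) * (1 - x * P ^ (c + r)) * (falling P (Suc c) a - falling P c a)
       - x * (1 - P ^ c) * (1 - P ^ (c + r)) * (falling P c a - falling P (c - 1) a))"
proof -
  have prev: "(1 - P ^ a) * (x ^ (a - 1) * falling P c (a - 1)) = x ^ a / x * falling P (Suc c) a"
  proof (cases a)
    case 0
    then show ?thesis using falling_eq_0[OF P(1), of 0 "Suc c"] by simp
  next
    case (Suc a')
    then show ?thesis using x by (simp add: falling_Suc_Suc[OF P(1)])
  qed
  have "(1 - P)\<^sup>2 * radial P r (\<lambda>a. x ^ a * falling P c a) a =
      (1 - P ^ (a + 1 + r)) * (x * x ^ a * falling P c (Suc a) - x ^ a * falling P c a)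
      - P * ((1 - P ^ a) * (x ^ a * falling P c a) - (1 - P ^ a) * (x ^ (a - 1) * falling P c (a - 1)))"
    unfolding radial_numerator[OF P(2)] by (simp add: algebra_simps)
  also have "\<dots> = x ^ a * ((1 - P ^ (a + 1 + r)) * (x * falling P c (Suc a) - falling P c a)
      - P * ((1 - P ^ a) * falling P c a - falling P (Suc c) a / x))"
    unfolding prev by (simp add: algebra_simps)
  also have "(1 - P ^ (a + 1 + r)) * (x * falling P c (Suc a) - falling P c a)
      - P * ((1 - P ^ a) * falling P c a - falling P (Suc c) a / x) =
      (1 - x) * (P - x) / x * falling P c a
       + P / x * (1 - x * P ^ c) * (1 - x * P ^ (c + r)) * (falling P (Suc c) a - falling P c a)
       - x * (1 - P ^ c) * (1 - P ^ (c + r)) * (falling P c a - falling P (c - 1) a)"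
  proof (cases c)
    case 0
    show ?thesis using x P
      by (simp add: 0 falling_Suc power_add field_simps)
  next
    case (Suc d)
    define Y where "Y = P ^ a"
    define R where "R = P ^ r"
    define D where "D = P ^ d"
    define F where "F = falling P d a"
    have D: "D \<noteq> 0" using P by (simp add: D_def)
    have f1: "falling P c a = F * (1 - Y / D)" by (simp add: Suc falling_Suc Y_def D_def F_def)
    have f2: "falling P (Suc c) a = F * (1 - Y / D) * (1 - Y / (P * D))"
      by (simp add: Suc falling_Suc Y_def D_def F_def)
    have f3: "falling P c (Suc a) = (1 - P * Y) * F"
      by (simp add: Suc falling_Suc_Suc[OF P(1)] Y_def F_def)
    have f4: "falling P (c - 1) a = F" by (simp add: Suc F_def)
    have p: "P ^ c = P * D" "P ^ (c + r) = P * D * R" "P ^ (a + 1 + r) = P * Y * R" "P ^ a = Y"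
      by (simp_all add: Suc D_def R_def Y_def power_add)
    show ?thesis unfolding f1 f2 f3 f4 p using x P D
      by (simp add: field_simps)
  qed
  finally show ?thesis .
qed

definition qpoch_poly :: "complex \<Rightarrow> nat \<Rightarrow> complex poly" where
  "qpoch_poly P n = (\<Prod>j<n. [:1, - (P ^ j):])"

lemma poly_qpoch_poly: "poly (qpoch_poly P n) x = (\<Prod>j<n. 1 - x * P ^ j)"
  by (simp add: qpoch_poly_def poly_prod)

lemma qpoch_poly_Suc: "poly (qpoch_poly P (Suc n)) x = poly (qpoch_poly P n) x * (1 - x * P ^ n)"
  by (simp add: poly_qpoch_poly)

lemma qpoch_poly_dilate: "(1 - x) * poly (qpoch_poly P n) (P * x) = poly (qpoch_poly P (Suc n)) x"
  unfolding poly_qpoch_poly prod.lessThan_Suc_shift by (simp add: mult_ac)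

lemma qpoch_poly_nonzero:
  assumes "norm P < 1"
  shows "poly (qpoch_poly P n) P \<noteq> 0"
proof -
  have "P * P ^ j \<noteq> 1" for j
  proof -
    have "norm P * norm P ^ j \<le> norm P * 1"
      by (intro mult_left_mono power_le_one) (use assms in auto)
    then have "norm (P * P ^ j) < 1" using assms by (simp add: norm_mult norm_power)
    then show ?thesis by force
  qed
  then show ?thesis by (auto simp: poly_qpoch_poly)
qed

definition invariant_coeff :: "complex \<Rightarrow> nat \<Rightarrow> nat \<Rightarrow> complex" where
  "invariant_coeff P r c = P ^ c / (poly (qpoch_poly P c) P * poly (qpoch_poly P (c + r)) P)"

text \<open>The coefficient of \<open>G\<^sub>l\<close> in bidegree \<open>(r, - r)\<close> at the point \<open>(p\<^sup>a, p\<^sup>b)\<close>, as a polynomial in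
  \<open>x = p\<^sup>l\<close>.  The natural bound for the summation is \<open>min a b\<close>; the terms with \<open>a < c \<le> b\<close> vanish
  through \<open>falling P c a\<close>, and a bound independent of \<open>a\<close> lets difference operators in \<open>a\<close> act term by term.\<close>

definition invariant_poly :: "complex \<Rightarrow> nat \<Rightarrow> nat \<Rightarrow> nat \<Rightarrow> complex poly" where
  "invariant_poly P r a b = (\<Sum>c\<le>b. smult (invariant_coeff P r c * falling P c a * falling P c b)
     (monom 1 ((a - c) + (b - c)) * (qpoch_poly P c * qpoch_poly P (c + r))))"

lemma poly_invariant_poly:
  "poly (invariant_poly P r a b) x = (\<Sum>c\<le>b. invariant_coeff P r c * falling P c a * falling P c b
     * (x ^ ((a - c) + (b - c)) * (poly (qpoch_poly P c) x * poly (qpoch_poly P (c + r)) x)))"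
  by (simp add: invariant_poly_def poly_sum poly_monom)

lemma radial_sum:
  "radial P r (\<lambda>a. \<Sum>i\<in>A. s i * F i a) j = (\<Sum>i\<in>A. s i * radial P r (F i) j)"
proof -
  have "radial P r (\<lambda>a. s * \<psi> a) j = s * radial P r \<psi> j" for s \<psi>
    by (simp add: radial_def algebra_simps diff_divide_distrib add_divide_distrib)
  moreover have "radial P r (\<lambda>a. \<psi> a + \<phi> a) j = radial P r \<psi> j + radial P r \<phi> j" for \<psi> \<phi>
    by (simp add: radial_def algebra_simps diff_divide_distrib add_divide_distrib)
  moreover have "radial P r (\<lambda>a. 0) j = 0" by (simp add: radial_def)
  ultimately show ?thesis
    by (induction A rule: infinite_finite_induct) simp_all
qed

text \<open>Expand both sides in the products \<open>falling c a \<cdot> falling c' b\<close> with \<open>\<bar>c - c'\<bar> \<le> 1\<close>.  On the left the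
  off-diagonal entries of the tridiagonal matrix, weighted by the coefficients of \<open>g\<^sub>x\<close>, are equal
  in both directions (\<open>step\<close>), so summation by parts turns their contribution into a sum over
  products of increments in \<open>a\<close> and in \<open>b\<close>.  On the right, \<open>g\<^bsub>px\<^esub>\<close> contains the extra factor
  \<open>p\<^bsup>a-c\<^esup> p\<^bsup>b-c\<^esup>\<close>, and multiplication of \<open>falling c\<close> by \<open>p\<^bsup>a-c\<^esup>\<close> is exactly minus such an
  increment (\<open>dil\<close>).\<close>

lemma radial_invariant_poly:
  assumes P: "P \<noteq> 0" "norm P < 1" and x: "x \<noteq> 0"
  shows "(1 - P)\<^sup>2 * radial P r (\<lambda>a. poly (invariant_poly P r a b) x) a =
     (1 - x) * (P - x) / x * poly (invariant_poly P r a b) x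
     - P * (1 - x)\<^sup>2 / x * poly (invariant_poly P r a b) (P * x)"
proof -
  have P1: "P \<noteq> 1" using P by auto
  define Q where "Q = (\<lambda>c. poly (qpoch_poly P c))"
  \<comment> \<open>\<open>s c\<close> is the coefficient of \<open>x\<^sup>a falling c a \<cdot> falling c b\<close> in \<open>g\<^sub>x\<close>; \<open>\<alpha> c\<close> and \<open>\<gamma> c\<close> are the
      off-diagonal entries of \<open>(1 - P)\<^sup>2 L\<close>.\<close>
  define s where "s c = invariant_coeff P r c * (Q c x * Q (c + r) x) * x ^ b / x ^ (2 * c)" for c
  define N where "N = falling P"
  define \<alpha> where "\<alpha> c = P / x * (1 - x * P ^ c) * (1 - x * P ^ (c + r))" for c
  define \<gamma> where "\<gamma> c = x * (1 - P ^ c) * (1 - P ^ (c + r))" for c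
  have expo: "N c a' * N c b * x ^ ((a' - c) + (b - c)) = N c a' * N c b * (x ^ a' * x ^ b / x ^ (2 * c))"
    if "x \<noteq> 0" for c a' :: nat and x :: complex
  proof (cases "c \<le> a' \<and> c \<le> b")
    case True
    have "(a' - c) + (b - c) + 2 * c = a' + b" using True by linarith
    then have "x ^ ((a' - c) + (b - c)) * x ^ (2 * c) = x ^ a' * x ^ b"
      by (metis power_add)
    then show ?thesis using that by (simp add: field_simps)
  next
    case False
    then show ?thesis using falling_eq_0[OF P(1)] by (auto simp: N_def)
  qed
  have g: "poly (invariant_poly P r a' b) x = (\<Sum>c\<le>b. s c * N c b * (x ^ a' * N c a'))" for a'
    unfolding poly_invariant_poly
  proof (intro sum.cong refl)
    fix c
    have "invariant_coeff P r c * falling P c a' * falling P c b * (x ^ ((a' - c) + (b - c))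
        * (Q c x * Q (c + r) x)) = invariant_coeff P r c * (Q c x * Q (c + r) x)
        * (N c a' * N c b * x ^ ((a' - c) + (b - c)))"
      by (simp add: N_def mult_ac)
    then show "invariant_coeff P r c * falling P c a' * falling P c b * (x ^ ((a' - c) + (b - c))
        * (poly (qpoch_poly P c) x * poly (qpoch_poly P (c + r)) x)) = s c * N c b * (x ^ a' * N c a')"
      unfolding expo[OF x] by (simp add: s_def Q_def mult_ac)
  qed
  have step: "\<gamma> (Suc c) * s (Suc c) = \<alpha> c * s c" for c
  proof -
    have "1 - P * P ^ c \<noteq> 0" "1 - P * P ^ (c + r) \<noteq> 0"
      using qpoch_poly_nonzero[OF P(2), of "Suc c"] qpoch_poly_nonzero[OF P(2), of "Suc (c + r)"]
      by (simp_all add: qpoch_poly_Suc)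
    moreover have "poly (qpoch_poly P n) P \<noteq> 0" for n by (rule qpoch_poly_nonzero[OF P(2)])
    ultimately show ?thesis using P x
      by (simp add: s_def \<alpha>_def \<gamma>_def Q_def invariant_coeff_def qpoch_poly_Suc)
        (simp add: field_simps power2_eq_square)
  qed
  have dil: "poly (invariant_poly P r a b) (P * x) * (P * (1 - x)\<^sup>2 / x) =
      (\<Sum>c\<le>b. x ^ a * s c * \<alpha> c * (N (Suc c) a - N c a) * (N (Suc c) b - N c b))"
    unfolding poly_invariant_poly sum_distrib_right
  proof (intro sum.cong refl)
    fix c
    let ?K = "invariant_coeff P r c"
    have Px: "P * x \<noteq> 0" using P x by simp
    have q: "(1 - x) * Q n (P * x) = Q n x * (1 - x * P ^ n)" for n
      unfolding Q_def qpoch_poly_dilate by (rule qpoch_poly_Suc)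
    have d: "N (Suc c) a - N c a = - (P ^ a / P ^ c) * N c a" for a
      by (simp add: N_def falling_Suc algebra_simps)
    have e: "N c a * N c b * (P * x) ^ ((a - c) + (b - c)) =
        x ^ a * (x ^ b / x ^ (2 * c)) * ((N (Suc c) a - N c a) * (N (Suc c) b - N c b))"
      unfolding expo[OF Px] d by (simp add: power_mult_distrib power_mult power2_eq_square field_simps)
    have "?K * N c a * N c b * ((P * x) ^ ((a - c) + (b - c)) * (Q c (P * x) * Q (c + r) (P * x)))
        * (P * (1 - x)\<^sup>2 / x) =
      ?K * (N c a * N c b * (P * x) ^ ((a - c) + (b - c))) *
        (((1 - x) * Q c (P * x)) * ((1 - x) * Q (c + r) (P * x))) * (P / x)"
      by (simp add: power2_eq_square mult_ac)
    also have "\<dots> = x ^ a * s c * \<alpha> c * (N (Suc c) a - N c a) * (N (Suc c) b - N c b)"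
      unfolding q e by (simp add: s_def \<alpha>_def mult_ac)
    finally show "?K * falling P c a * falling P c b * ((P * x) ^ ((a - c) + (b - c)) *
        (poly (qpoch_poly P c) (P * x) * poly (qpoch_poly P (c + r)) (P * x)))
        * (P * (1 - x)\<^sup>2 / x) =
        x ^ a * s c * \<alpha> c * (N (Suc c) a - N c a) * (N (Suc c) b - N c b)"
      by (simp add: N_def Q_def)
  qed
  have "(1 - P)\<^sup>2 * radial P r (\<lambda>a. poly (invariant_poly P r a b) x) a =
     (\<Sum>c\<le>b. s c * N c b * ((1 - P)\<^sup>2 * radial P r (\<lambda>a. x ^ a * N c a) a))"
    unfolding g radial_sum by (simp add: sum_distrib_left mult_ac)
  also have "\<dots> = (\<Sum>c\<le>b. (1 - x) * (P - x) / x * (s c * N c b * (x ^ a * N c a))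
      + x ^ a * s c * \<alpha> c * N c b * (N (Suc c) a - N c a)
      - x ^ a * s c * \<gamma> c * N c b * (N c a - N (c - 1) a))"
    unfolding N_def radial_power_falling[OF P(1) P1 x] \<alpha>_def[symmetric] \<gamma>_def[symmetric]
    by (intro sum.cong refl) (simp add: algebra_simps)
  also have "\<dots> = (1 - x) * (P - x) / x * poly (invariant_poly P r a b) x
      + (\<Sum>c\<le>b. x ^ a * s c * \<alpha> c * N c b * (N (Suc c) a - N c a))
      - (\<Sum>c\<le>b. x ^ a * s c * \<gamma> c * N c b * (N c a - N (c - 1) a))"
    unfolding g by (simp add: sum.distrib sum_subtractf sum_distrib_left)
  also have "(\<Sum>c\<le>b. x ^ a * s c * \<gamma> c * N c b * (N c a - N (c - 1) a)) =
      (\<Sum>c\<le>Suc b. x ^ a * s c * \<gamma> c * N c b * (N c a - N (c - 1) a))"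
    using falling_eq_0[OF P(1), of b "Suc b"] by (simp add: N_def)
  also have "\<dots> = (\<Sum>c\<le>b. x ^ a * s (Suc c) * \<gamma> (Suc c) * N (Suc c) b * (N (Suc c) a - N c a))"
    unfolding sum.atMost_Suc_shift by (simp add: \<gamma>_def)
  also have "\<dots> = (\<Sum>c\<le>b. x ^ a * s c * \<alpha> c * N (Suc c) b * (N (Suc c) a - N c a))"
    using step by (intro sum.cong refl) (metis mult.assoc mult.commute)
  also have "(1 - x) * (P - x) / x * poly (invariant_poly P r a b) x
      + (\<Sum>c\<le>b. x ^ a * s c * \<alpha> c * N c b * (N (Suc c) a - N c a)) - \<dots> =
     (1 - x) * (P - x) / x * poly (invariant_poly P r a b) x
     - poly (invariant_poly P r a b) (P * x) * (P * (1 - x)\<^sup>2 / x)"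
    unfolding dil by (simp add: sum_subtractf sum.distrib algebra_simps)
  finally show ?thesis by (simp add: mult_ac)
qed

section \<open>Euler derivatives and the telescoping identities\<close>

text \<open>The operator \<open>D = x d/dx\<close>.  Since \<open>x = p\<^sup>l\<close>, it is the derivative in \<open>l\<close> divided by \<open>ln p\<close>.\<close>

definition euler :: "complex poly \<Rightarrow> complex poly" where
  "euler f = [:0, 1:] * pderiv f"

lemma poly_euler: "poly (euler f) x = x * poly (pderiv f) x"
  by (simp add: euler_def)

lemma euler_add: "euler (f + g) = euler f + euler g"
  by (simp add: euler_def pderiv_add algebra_simps)

text \<open>The operator \<open>L\<close> has coefficients free of \<open>x\<close>, so it commutes with \<open>D\<close>: apply \<open>D\<close> to the relation of
  \<open>radial_invariant_poly\<close>, which holds on the open set \<open>x \<noteq> 0\<close>.\<close>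

lemma radial_euler:
  fixes P x :: complex and r a b :: nat
  defines "g \<equiv> poly (invariant_poly P r a b)" and "g' \<equiv> poly (euler (invariant_poly P r a b))"
  assumes P: "P \<noteq> 0" "norm P < 1" and x: "x \<noteq> 0"
  shows "(1 - P)\<^sup>2 * radial P r (\<lambda>a. poly (euler (invariant_poly P r a b)) x) a =
     (x - P / x) * g x + (P / x - 1 - P + x) * g' x
     - P * (x - 1 / x) * g (P * x) - P * (1 / x - 2 + x) * g' (P * x)"
proof -
  let ?f = "\<lambda>a. invariant_poly P r a b"
  define L where "L x = (1 - P)\<^sup>2 * radial P r (\<lambda>a. poly (?f a) x) a" for x
  define R where "R x = (P / x - 1 - P + x) * g x - P * (1 / x - 2 + x) * g (P * x)" for x
  have P1: "P \<noteq> 1" using P by auto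
  have dL: "(L has_field_derivative (1 - P)\<^sup>2 * radial P r (\<lambda>a. poly (pderiv (?f a)) x) a) (at x)"
    unfolding L_def radial_numerator[OF P1]
    by (rule derivative_eq_intros poly_DERIV refl | simp)+
  have dg: "((\<lambda>x. g (P * x)) has_field_derivative poly (pderiv (?f a)) (P * x) * P) (at x)"
    unfolding g_def by (rule DERIV_chain'[of "\<lambda>x. P * x"]) (auto intro!: derivative_eq_intros poly_DERIV)
  have d1: "((\<lambda>x. P / x - 1 - P + x) has_field_derivative (1 - P / x\<^sup>2)) (at x)"
    using x by (auto intro!: derivative_eq_intros simp: power2_eq_square field_simps)
  have d2: "((\<lambda>x. P * (1 / x - 2 + x)) has_field_derivative P * (1 - 1 / x\<^sup>2)) (at x)"
    using x by (auto intro!: derivative_eq_intros simp: power2_eq_square field_simps)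
  have dg0: "(g has_field_derivative poly (pderiv (?f a)) x) (at x)"
    unfolding g_def by (rule poly_DERIV)
  have dR: "(R has_field_derivative (1 - P / x\<^sup>2) * g x + (P / x - 1 - P + x) * poly (pderiv (?f a)) x
     - (P * (1 - 1 / x\<^sup>2) * g (P * x) + P * (1 / x - 2 + x) * (poly (pderiv (?f a)) (P * x) * P))) (at x)"
    unfolding R_def
    by (rule DERIV_cong[OF DERIV_diff[OF DERIV_mult[OF d1 dg0] DERIV_mult[OF d2 dg]]]) simp
  have "L w = R w" if "w \<in> - {0}" for w
  proof -
    have w: "w \<noteq> 0" using that by simp
    have "(1 - w) * (P - w) / w = P / w - 1 - P + w" "P * (1 - w)\<^sup>2 / w = P * (1 / w - 2 + w)"
      using w by (simp_all add: field_simps power2_eq_square)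
    then show ?thesis unfolding L_def R_def g_def radial_invariant_poly[OF P w] by simp
  qed
  then have "(R has_field_derivative (1 - P)\<^sup>2 * radial P r (\<lambda>a. poly (pderiv (?f a)) x) a) (at x)"
    by (intro has_field_derivative_transform_within_open[OF dL, of "- {0}"]) (use x in auto)
  from DERIV_unique[OF this dR]
  have "x * ((1 - P)\<^sup>2 * radial P r (\<lambda>a. poly (pderiv (?f a)) x) a) =
    x * ((1 - P / x\<^sup>2) * g x + (P / x - 1 - P + x) * poly (pderiv (?f a)) x
     - (P * (1 - 1 / x\<^sup>2) * g (P * x) + P * (1 / x - 2 + x) * (poly (pderiv (?f a)) (P * x) * P)))"
    by simp
  also have "x * ((1 - P)\<^sup>2 * radial P r (\<lambda>a. poly (pderiv (?f a)) x) a) =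
    (1 - P)\<^sup>2 * radial P r (\<lambda>a. poly (euler (?f a)) x) a"
    unfolding radial_numerator[OF P1] poly_euler by (simp add: algebra_simps)
  finally have *: "(1 - P)\<^sup>2 * radial P r (\<lambda>a. poly (euler (?f a)) x) a =
     x * ((1 - P / x\<^sup>2) * g x + (P / x - 1 - P + x) * poly (pderiv (?f a)) x
     - (P * (1 - 1 / x\<^sup>2) * g (P * x) + P * (1 / x - 2 + x) * (poly (pderiv (?f a)) (P * x) * P)))" .
  have distr: "x * (A * u + B * p - (P * C * v + P * D * (s * P))) =
     (x * A) * u + B * (x * p) - P * (x * C) * v - P * D * ((P * x) * s)" for A B C D u v p s
    by (simp add: algebra_simps)
  have "x * (1 - P / x\<^sup>2) = x - P / x" "x * (1 - 1 / x\<^sup>2) = x - 1 / x"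
    using x by (simp_all add: field_simps power2_eq_square)
  then show ?thesis using * by (simp only: distr g'_def poly_euler)
qed

text \<open>The function whose value at \<open>x = p\<^sup>m\<close> is \<open>(p\<^sup>-\<^sup>1 - 1) / (p\<^sup>-\<^sup>m - 1)\<close>.\<close>

definition green1_coeff :: "complex \<Rightarrow> complex \<Rightarrow> complex" where
  "green1_coeff P x = (1 - P) / P * (x / (1 - x))"

text \<open>The function whose value at \<open>x = p\<^sup>m\<close> is the coefficient of \<open>G\<^sub>m\<close> in the second Green kernel.\<close>

definition green2_coeff :: "complex \<Rightarrow> complex \<Rightarrow> complex" where
  "green2_coeff P x = (1 - P)\<^sup>2 / P * (x * (1 + x) / (1 - x)\<^sup>2)"

text \<open>The right-hand side is a difference: the factor \<open>1 - x\<close> of the second term is the factor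
  \<open>1 - x/P\<close> of the first one taken at \<open>P x\<close>.\<close>

lemma radial_green1_term:
  assumes P: "P \<noteq> 0" "norm P < 1" and x: "x \<noteq> 0" "x \<noteq> 1"
  shows "green1_coeff P x * radial P r (\<lambda>a. poly (invariant_poly P r a b) x) a =
    ((1 - x / P) * poly (invariant_poly P r a b) x
      - (1 - x) * poly (invariant_poly P r a b) (P * x)) / (1 - P)"
proof -
  have P1: "P \<noteq> 1" using P by auto
  define L where "L = radial P r (\<lambda>a. poly (invariant_poly P r a b) x) a"
  have "green1_coeff P x * L = (1 / (P * (1 - P))) * (x / (1 - x)) * ((1 - P)\<^sup>2 * L)"
    using P(1) P1 x by (simp add: green1_coeff_def power2_eq_square)
  also have "\<dots> = ((1 - x / P) * poly (invariant_poly P r a b) x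
      - (1 - x) * poly (invariant_poly P r a b) (P * x)) / (1 - P)"
    unfolding L_def radial_invariant_poly[OF P x(1)]
    using P(1) P1 x by (simp add: divide_simps) (simp add: algebra_simps power2_eq_square)
  finally show ?thesis unfolding L_def .
qed

text \<open>The coefficient \<open>d(x)\<close> is forced by this identity.  Its ratio to \<open>(1 - P) c(x)\<close> is
  \<open>(1 + x)/(1 - x) = - (D \<mu>)/\<mu>\<close>, with \<open>\<mu> = - P (1 - x)\<^sup>2 / (x (1 - P)\<^sup>2)\<close> the coefficient of \<open>g\<^bsub>Px\<^esub>\<close> in \<open>L g\<^sub>x\<close>,
  which removes the undifferentiated value at \<open>P x\<close>; what is left at \<open>x\<close> without a derivative is
  \<open>- c(x) g\<^sub>x\<close>.\<close>

lemma radial_green2_term: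
  assumes P: "P \<noteq> 0" "norm P < 1" and x: "x \<noteq> 0" "x \<noteq> 1"
  shows "green2_coeff P x * radial P r (\<lambda>a. poly (invariant_poly P r a b) x) a
     + (1 - P) * green1_coeff P x * radial P r (\<lambda>a. poly (euler (invariant_poly P r a b)) x) a =
    - green1_coeff P x * poly (invariant_poly P r a b) x
     + ((1 - x / P) * poly (euler (invariant_poly P r a b)) x
        - (1 - x) * poly (euler (invariant_poly P r a b)) (P * x))"
proof -
  have P1: "P \<noteq> 1" using P by auto
  define L where "L = radial P r (\<lambda>a. poly (euler (invariant_poly P r a b)) x) a"
  define g where "g = poly (invariant_poly P r a b) x"
  define h where "h = poly (invariant_poly P r a b) (P * x)"
  define g' where "g' = poly (euler (invariant_poly P r a b)) x"
  define h' where "h' = poly (euler (invariant_poly P r a b)) (P * x)"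
  have L1: "radial P r (\<lambda>a. poly (invariant_poly P r a b) x) a =
     ((1 - x) * (P - x) / x * g - P * (1 - x)\<^sup>2 / x * h) / (1 - P)\<^sup>2"
    using radial_invariant_poly[OF P x(1), of r b a] P1
    by (simp add: g_def h_def eq_divide_eq mult.commute)
  have L: "L = ((x - P / x) * g + (P / x - 1 - P + x) * g'
     - P * (x - 1 / x) * h - P * (1 / x - 2 + x) * h') / (1 - P)\<^sup>2"
    using radial_euler[OF P x(1), of r b a] P1
    by (simp add: L_def g_def h_def g'_def h'_def eq_divide_eq mult.commute)
  show ?thesis
    unfolding L1 g_def[symmetric] h_def[symmetric] g'_def[symmetric]
      h'_def[symmetric] L_def[symmetric] L green1_coeff_def green2_coeff_def
    using P(1) P1 x by (simp add: divide_simps) (simp add: algebra_simps power2_eq_square)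
qed

text \<open>The bound that the Green series needs: \<open>F a\<close> is divisible by \<open>x\<^bsup>a-b\<^esup>\<close> with a quotient bounded on the
  unit disc uniformly in \<open>a\<close>, and differentiation costs a factor linear in \<open>a\<close>.\<close>

definition decays :: "nat \<Rightarrow> (nat \<Rightarrow> complex poly) \<Rightarrow> bool" where
  "decays b F \<longleftrightarrow> (\<exists>C\<ge>0. \<forall>a x. norm x \<le> 1 \<longrightarrow>
      norm (poly (F a) x) \<le> C * norm x ^ (a - b) \<and>
      norm (poly (euler (F a)) x) \<le> C * real (a + b + 1) * norm x ^ (a - b))"

lemma decays_sum:
  assumes "\<And>i. i \<in> A \<Longrightarrow> decays b (F i)"
  shows "decays b (\<lambda>a. \<Sum>i\<in>A. F i a)"
  using assms
proof (induction A rule: infinite_finite_induct)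
  case (insert i A)
  from insert obtain C where C: "C \<ge> 0" "\<And>a x. norm x \<le> 1 \<Longrightarrow> norm (poly (\<Sum>i\<in>A. F i a) x) \<le> C * norm x ^ (a - b)"
    "\<And>a x. norm x \<le> 1 \<Longrightarrow> norm (poly (euler (\<Sum>i\<in>A. F i a)) x) \<le> C * real (a + b + 1) * norm x ^ (a - b)"
    unfolding decays_def by fast
  from insert have "decays b (F i)" by blast
  then obtain D where D: "D \<ge> 0" "\<And>a x. norm x \<le> 1 \<Longrightarrow> norm (poly (F i a) x) \<le> D * norm x ^ (a - b)"
    "\<And>a x. norm x \<le> 1 \<Longrightarrow> norm (poly (euler (F i a)) x) \<le> D * real (a + b + 1) * norm x ^ (a - b)"
    unfolding decays_def by fast
  show ?case unfolding decays_def
  proof (intro exI[of _ "D + C"] conjI allI impI)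
    fix a and x :: complex assume x: "norm x \<le> 1"
    have "norm (poly (\<Sum>i\<in>insert i A. F i a) x) \<le> norm (poly (F i a) x) + norm (poly (\<Sum>i\<in>A. F i a) x)"
      using insert.hyps by (simp add: norm_triangle_ineq)
    then show "norm (poly (\<Sum>i\<in>insert i A. F i a) x) \<le> (D + C) * norm x ^ (a - b)"
      using C(2)[OF x, of a] D(2)[OF x, of a] by (simp add: algebra_simps)
    have "norm (poly (euler (\<Sum>i\<in>insert i A. F i a)) x)
        \<le> norm (poly (euler (F i a)) x) + norm (poly (euler (\<Sum>i\<in>A. F i a)) x)"
      using insert.hyps by (simp add: euler_add norm_triangle_ineq)
    then show "norm (poly (euler (\<Sum>i\<in>insert i A. F i a)) x) \<le> (D + C) * real (a + b + 1) * norm x ^ (a - b)"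
      using C(3)[OF x, of a] D(3)[OF x, of a] by (simp add: algebra_simps)
  qed (use C D in auto)
qed (auto simp: decays_def euler_def)

lemma poly_bounded_unit_disc:
  fixes f :: "complex poly"
  obtains C where "C \<ge> 0" "\<And>x. norm x \<le> 1 \<Longrightarrow> norm (poly f x) \<le> C"
proof -
  have "bounded (poly f ` cball 0 1)"
    by (intro compact_imp_bounded compact_continuous_image continuous_intros compact_cball)
  then obtain C where "\<And>x. norm x \<le> 1 \<Longrightarrow> norm (poly f x) \<le> C"
    unfolding bounded_iff by (metis imageI mem_cball_0)
  moreover from this[of 0] have "C \<ge> 0" using norm_ge_zero[of "poly f 0"] by (simp add: order_trans[OF norm_ge_zero])
  ultimately show ?thesis using that by blast
qed

lemma decays_monom:
  assumes s: "\<And>a. norm (s a) \<le> S" and e: "\<And>a. a - b \<le> e a" "\<And>a. e a \<le> a + b"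
  shows "decays b (\<lambda>a. smult (s a) (monom 1 (e a) * Q))"
proof -
  obtain C where C: "C \<ge> 0" "\<And>x. norm x \<le> 1 \<Longrightarrow> norm (poly Q x) \<le> C"
    using poly_bounded_unit_disc[of Q] by metis
  obtain D where D: "D \<ge> 0" "\<And>x. norm x \<le> 1 \<Longrightarrow> norm (poly (pderiv Q) x) \<le> D"
    using poly_bounded_unit_disc[of "pderiv Q"] by metis
  have S: "S \<ge> 0" using s[of 0] norm_ge_zero order_trans by blast
  show ?thesis unfolding decays_def
  proof (intro exI[of _ "S * (C + D)"] conjI allI impI)
    fix a and x :: complex assume x: "norm x \<le> 1"
    have xe: "norm x ^ e a \<le> norm x ^ (a - b)" by (rule power_decreasing[OF e(1) _ x]) simp
    have "norm (poly (smult (s a) (monom 1 (e a) * Q)) x) = norm (s a) * (norm x ^ e a * norm (poly Q x))"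
      by (simp add: poly_monom norm_mult norm_power)
    also have "\<dots> \<le> S * (norm x ^ (a - b) * (C + D))"
      using C(2)[OF x] D(1) C(1) by (intro mult_mono s xe) (auto simp: S)
    finally show "norm (poly (smult (s a) (monom 1 (e a) * Q)) x) \<le> S * (C + D) * norm x ^ (a - b)"
      by (simp add: mult_ac)
    have *: "x * (of_nat (e a) * x ^ (e a - 1)) = of_nat (e a) * x ^ e a"
      by (cases "e a") auto
    have "poly (euler (smult (s a) (monom 1 (e a) * Q))) x =
       s a * (x ^ e a * (of_nat (e a) * poly Q x + x * poly (pderiv Q) x))"
      using * by (auto simp: poly_euler pderiv_smult pderiv_mult pderiv_monom poly_monom algebra_simps)
    also have "norm \<dots> \<le> S * (norm x ^ (a - b) * (real (a + b) * C + 1 * D))"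
      unfolding norm_mult norm_power
    proof (intro mult_mono s xe order_trans[OF norm_triangle_ineq] add_mono)
      show "norm (of_nat (e a) * poly Q x) \<le> real (a + b) * C"
        unfolding norm_mult using C(2)[OF x] e(2)[of a] by (intro mult_mono) auto
      show "norm (x * poly (pderiv Q) x) \<le> 1 * D"
        unfolding norm_mult using D(2)[OF x] x by (intro mult_mono) auto
    qed (auto simp: S)
    also have "\<dots> \<le> S * (norm x ^ (a - b) * ((C + D) * real (a + b + 1)))"
      using C(1) D(1) by (intro mult_left_mono) (auto simp: S algebra_simps)
    finally show "norm (poly (euler (smult (s a) (monom 1 (e a) * Q))) x)
        \<le> S * (C + D) * real (a + b + 1) * norm x ^ (a - b)"
      by (simp add: mult_ac)
  qed (use C D S in auto)
qed

lemma norm_falling_le: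
  assumes "norm P \<le> 1"
  shows "norm (falling P c a) \<le> (\<Prod>t<c. 1 + 1 / norm P ^ t)"
  unfolding falling_def prod_norm[symmetric]
proof (intro prod_mono conjI norm_ge_zero)
  fix t
  have "norm (1 - P ^ a / P ^ t) \<le> 1 + norm P ^ a / norm P ^ t"
    by (rule order_trans[OF norm_triangle_ineq4]) (simp add: norm_divide norm_power)
  also have "\<dots> \<le> 1 + 1 / norm P ^ t"
    using assms by (intro add_left_mono divide_right_mono power_le_one) auto
  finally show "norm (1 - P ^ a / P ^ t) \<le> 1 + 1 / norm P ^ t" .
qed

lemma decays_invariant_poly:
  assumes "norm P \<le> 1"
  shows "decays b (\<lambda>a. invariant_poly P r a b)"
  unfolding invariant_poly_def
proof (rule decays_sum)
  fix c assume c: "c \<in> {..b}"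
  define M where "M = (\<Prod>t<c. 1 + 1 / norm P ^ t)"
  have M: "norm (falling P c a) \<le> M" for a
    unfolding M_def by (rule norm_falling_le[OF assms])
  have M0: "M \<ge> 0" using M[of 0] norm_ge_zero order_trans by blast
  show "decays b (\<lambda>a. smult (invariant_coeff P r c * falling P c a * falling P c b)
        (monom 1 (a - c + (b - c)) * (qpoch_poly P c * qpoch_poly P (c + r))))"
  proof (rule decays_monom)
    show "norm (invariant_coeff P r c * falling P c a * falling P c b)
        \<le> norm (invariant_coeff P r c) * M * M" for a
      unfolding norm_mult by (intro mult_mono M) (auto simp: M0)
  qed (use c in auto)
qed

section \<open>The Green series in one degree\<close>

text \<open>This is the limit \<open>l \<longlonglongrightarrow> \<infinity>\<close> of \<open>G\<^sub>l\<close>.  At \<open>x = 0\<close> only an exponent \<open>(a - c) + (b - c) = 0\<close> survives, hence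
  \<open>c \<ge> a\<close> and \<open>c = b\<close>, while \<open>falling\<close> requires \<open>c \<le> a\<close>.\<close>

lemma poly_invariant_poly_0:
  assumes P: "P \<noteq> 0" "norm P < 1"
  shows "poly (invariant_poly P r a b) 0 = (if a = b then P ^ b / (\<Prod>i=1..r. 1 - P ^ (i + b)) else 0)"
proof -
  let ?t = "\<lambda>c. invariant_coeff P r c * falling P c a * falling P c b
     * (0 ^ ((a - c) + (b - c)) * (poly (qpoch_poly P c) 0 * poly (qpoch_poly P (c + r)) 0))"
  have "poly (invariant_poly P r a b) 0 = (\<Sum>c\<le>b. if c = b then ?t c else 0)"
    unfolding poly_invariant_poly by (intro sum.cong refl) auto
  then have 1: "poly (invariant_poly P r a b) 0 =
      invariant_coeff P r b * falling P b a * falling P b b * 0 ^ (a - b)"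
    by (simp add: poly_qpoch_poly)
  show ?thesis
  proof (cases a b rule: linorder_cases)
    case less
    then show ?thesis by (simp add: 1 falling_eq_0[OF P(1)])
  next
    case greater
    then show ?thesis by (simp add: 1)
  next
    case equal
    have "falling P b b = (\<Prod>t<b. 1 - P ^ (b - t))"
      unfolding falling_def by (intro prod.cong refl) (simp add: power_diff P)
    also have "\<dots> = (\<Prod>j<b. 1 - P ^ (b - (b - Suc j)))"
      by (rule prod.nat_diff_reindex[symmetric])
    also have "\<dots> = poly (qpoch_poly P b) P"
      unfolding poly_qpoch_poly by (intro prod.cong refl) (simp add: Suc_diff_Suc)
    finally have f: "falling P b b = poly (qpoch_poly P b) P" .
    have q: "poly (qpoch_poly P (b + r)) P = poly (qpoch_poly P b) P * (\<Prod>i=1..r. 1 - P ^ (i + b))"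
      by (induction r) (simp_all add: qpoch_poly_Suc power_add mult_ac)
    have "poly (qpoch_poly P b) P \<noteq> 0" by (rule qpoch_poly_nonzero[OF P(2)])
    then show ?thesis unfolding 1 by (simp add: equal f invariant_coeff_def q)
  qed
qed

lemma weighted_series_bound:
  fixes co v :: "nat \<Rightarrow> complex" and p :: real
  assumes p: "0 < p" "p < 1" and co: "\<And>m. norm (co m) \<le> K * p ^ (m + 1)"
    and v: "\<And>m. norm (v m) \<le> C * (p ^ (m + 1)) ^ d" and C: "0 \<le> C"
  shows "summable (\<lambda>m. co m * v m)" "norm (\<Sum>m. co m * v m) \<le> K * C / (1 - p) * p ^ d"
proof -
  have K: "K * p ^ (m + 1) \<ge> 0" for m using co[of m] norm_ge_zero order_trans by blast
  have b: "norm (co m * v m) \<le> (K * p * C * p ^ d) * p ^ m" for m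
  proof -
    have "p ^ (m + 1) \<le> p ^ 1" by (rule power_decreasing) (use p in auto)
    then have "(p ^ (m + 1)) ^ d \<le> p ^ d" using p by (intro power_mono) auto
    then have "norm (v m) \<le> C * p ^ d" using v[of m] mult_left_mono[OF _ C] order_trans by blast
    then have "norm (co m * v m) \<le> (K * p ^ (m + 1)) * (C * p ^ d)"
      unfolding norm_mult by (intro mult_mono co K) auto
    then show ?thesis by (simp add: mult_ac)
  qed
  have geo: "summable (\<lambda>m. (K * p * C * p ^ d) * p ^ m)"
    using p by (intro summable_mult summable_geometric) auto
  show "summable (\<lambda>m. co m * v m)" by (rule summable_comparison_test'[OF geo b])
  have "norm (\<Sum>m. co m * v m) \<le> (\<Sum>m. (K * p * C * p ^ d) * p ^ m)"
    by (rule norm_suminf_le[OF b geo])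
  also have "\<dots> = (K * p * C * p ^ d) * (1 / (1 - p))"
    using p by (subst suminf_mult) (auto simp: suminf_geometric summable_geometric)
  also have "\<dots> \<le> K * C / (1 - p) * p ^ d"
  proof -
    have "K \<ge> 0" using K[of 0] p by (simp add: zero_le_mult_iff)
    then have "K * p \<le> K" using p by (simp add: mult_left_le)
    then have "(K * p) * (C * p ^ d / (1 - p)) \<le> K * (C * p ^ d / (1 - p))"
      using p C by (intro mult_right_mono) auto
    then show ?thesis by (simp add: mult_ac)
  qed
  finally show "norm (\<Sum>m. co m * v m) \<le> K * C / (1 - p) * p ^ d" .
qed

text \<open>The ratio occurs both in real estimates and in complex identities, as \<open>p\<close> and \<open>P\<close>.
  Keeping \<open>P\<close> as a variable prevents the simplifier from distributing \<open>of_real\<close> over powers.\<close>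

locale unit_ratio =
  fixes p :: real and P :: complex
  assumes p: "0 < p" "p < 1" and P_def: "P = complex_of_real p"
begin

lemma P_nz: "P \<noteq> 0" and norm_P: "norm P < 1" and P_ne_1: "P \<noteq> 1"
  using p by (auto simp: P_def)

lemma norm_P_power: "norm (P ^ n) = p ^ n"
  using p by (simp add: P_def norm_power)

text \<open>The points \<open>x = p\<^sup>m\<close> for \<open>m = 1, 2, \<dots>\<close>, indexed from 0.\<close>

definition node :: "nat \<Rightarrow> complex" where
  "node m = P ^ Suc m"

lemma norm_node: "norm (node m) = p ^ (m + 1)"
  unfolding node_def norm_P_power by simp

lemma norm_node_le: "norm (node m) \<le> p"
  using power_decreasing[of 1 "m + 1" p] p by (simp add: norm_node)

lemma node_nz: "node m \<noteq> 0" and node_ne_1: "node m \<noteq> 1"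
  and norm_node_le_1: "norm (node m) \<le> 1"
  using norm_node_le[of m] p P_nz by (auto simp: node_def)

lemma node_tendsto: "node \<longlonglongrightarrow> 0"
  unfolding node_def[abs_def] using LIMSEQ_power_zero[OF norm_P] by (rule LIMSEQ_Suc)

lemma green_coeffs_bounded:
  "\<exists>K. \<forall>m. norm (green1_coeff P (node m)) \<le> K * p ^ (m + 1) \<and>
     norm (green2_coeff P (node m)) \<le> K * p ^ (m + 1)"
proof (intro exI allI conjI)
  define K1 where "K1 = norm ((1 - P) / P) / (1 - p)"
  define K2 where "K2 = norm ((1 - P)\<^sup>2 / P) * 2 / (1 - p)\<^sup>2"
  have K: "K1 \<ge> 0" "K2 \<ge> 0" using p by (auto simp: K1_def K2_def)
  have d: "1 - p \<le> norm (1 - node m)" for m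
    using norm_triangle_ineq2[of 1 "node m"] norm_node_le[of m] by simp
  fix m
  have "norm (green1_coeff P (node m)) = norm ((1 - P) / P) * (p ^ (m + 1) / norm (1 - node m))"
    unfolding green1_coeff_def norm_mult norm_divide[of "node m"] norm_node ..
  also have "\<dots> \<le> norm ((1 - P) / P) * (p ^ (m + 1) / (1 - p))"
    by (intro mult_left_mono divide_left_mono d mult_pos_pos)
      (use p d[of m] in auto)
  also have "\<dots> = K1 * p ^ (m + 1)" by (simp add: K1_def)
  also have "\<dots> \<le> (K1 + K2) * p ^ (m + 1)" using K p by (intro mult_right_mono) auto
  finally show "norm (green1_coeff P (node m)) \<le> (K1 + K2) * p ^ (m + 1)" .
  have "norm (green2_coeff P (node m)) =
      norm ((1 - P)\<^sup>2 / P) * (p ^ (m + 1) * norm (1 + node m) / (norm (1 - node m))\<^sup>2)"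
    unfolding green2_coeff_def norm_mult norm_divide[of "node m * _"] norm_node norm_power ..
  also have "\<dots> \<le> norm ((1 - P)\<^sup>2 / P) * (p ^ (m + 1) * 2 / (1 - p)\<^sup>2)"
  proof (intro mult_left_mono frac_le power_mono d)
    show "norm (1 + node m) \<le> 2"
      using norm_triangle_ineq[of 1 "node m"] norm_node_le_1[of m] by simp
  qed (use p in auto)
  also have "\<dots> = K2 * p ^ (m + 1)" by (simp add: K2_def)
  also have "\<dots> \<le> (K1 + K2) * p ^ (m + 1)" using K p by (intro mult_right_mono) auto
  finally show "norm (green2_coeff P (node m)) \<le> (K1 + K2) * p ^ (m + 1)" .
qed

text \<open>The coefficients of the two Green kernels in one degree.  The factor \<open>1 - P\<close> in the second one
  is \<open>- (1 - p)/h\<close> times the factor \<open>ln p = - h\<close> that relates the derivative in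
  \<open>l\<close> to \<open>D\<close>.\<close>

definition green1_radial :: "nat \<Rightarrow> nat \<Rightarrow> nat \<Rightarrow> complex" where
  "green1_radial r a b = - (\<Sum>m. green1_coeff P (node m) * poly (invariant_poly P r a b) (node m))"

definition green2_radial :: "nat \<Rightarrow> nat \<Rightarrow> nat \<Rightarrow> complex" where
  "green2_radial r a b = (\<Sum>m. green2_coeff P (node m) * poly (invariant_poly P r a b) (node m))
     + (1 - P) * (\<Sum>m. green1_coeff P (node m) * poly (euler (invariant_poly P r a b)) (node m))"

lemma
  shows green1_summable:
      "summable (\<lambda>m. green1_coeff P (node m) * poly (invariant_poly P r a b) (node m))"
    and green2_summable:
      "summable (\<lambda>m. green2_coeff P (node m) * poly (invariant_poly P r a b) (node m))"
    and green1_euler_summable: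
      "summable (\<lambda>m. green1_coeff P (node m) * poly (euler (invariant_poly P r a b)) (node m))"
    and green_radial_decay: "\<exists>C\<ge>0. \<forall>a.
      norm (green1_radial r a b) \<le> C * real (a + b + 1) * p ^ (a - b) \<and>
      norm (green2_radial r a b) \<le> C * real (a + b + 1) * p ^ (a - b)"
proof -
  obtain C where C: "C \<ge> 0" "\<And>a x. norm x \<le> 1 \<Longrightarrow> norm (poly (invariant_poly P r a b) x) \<le> C * norm x ^ (a - b)"
    "\<And>a x. norm x \<le> 1 \<Longrightarrow> norm (poly (euler (invariant_poly P r a b)) x) \<le> C * real (a + b + 1) * norm x ^ (a - b)"
    using decays_invariant_poly[OF less_imp_le[OF norm_P], of b r] unfolding decays_def by fast
  obtain K where K_all: "\<forall>m. norm (green1_coeff P (node m)) \<le> K * p ^ (m + 1) \<and>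
     norm (green2_coeff P (node m)) \<le> K * p ^ (m + 1)"
    using green_coeffs_bounded by (rule exE)
  then have K: "norm (green1_coeff P (node m)) \<le> K * p ^ (m + 1)"
    "norm (green2_coeff P (node m)) \<le> K * p ^ (m + 1)" for m
    by (simp_all only:)
  have K0: "K \<ge> 0" using order_trans[OF norm_ge_zero K(1)[of 0]] p by (simp add: zero_le_mult_iff)
  have C2: "C * real (a + b + 1) \<ge> 0" for a using C(1) by simp
  have v1: "norm (poly (invariant_poly P r a b) (node m)) \<le> C * (p ^ (m + 1)) ^ (a - b)" for a m
    using C(2)[OF norm_node_le_1] unfolding norm_node .
  have v2: "norm (poly (euler (invariant_poly P r a b)) (node m))
      \<le> C * real (a + b + 1) * (p ^ (m + 1)) ^ (a - b)" for a m
    using C(3)[OF norm_node_le_1] unfolding norm_node .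
  note s1 = weighted_series_bound[OF p K(1) v1 C(1)]
  note s2 = weighted_series_bound[OF p K(2) v1 C(1)]
  note s3 = weighted_series_bound[OF p K(1) v2 C2]
  define D where "D = 2 * (K * C / (1 - p))"
  have D: "D * real (a + b + 1) * p ^ (a - b) = 2 * (K * C / (1 - p) * real (a + b + 1) * p ^ (a - b))" for a
    by (simp only: D_def mult.assoc)
  have KC: "K * C / (1 - p) \<ge> 0" using K0 C(1) p by simp
  have w: "K * C / (1 - p) * p ^ (a - b) \<le> K * C / (1 - p) * real (a + b + 1) * p ^ (a - b)" for a
  proof (rule mult_right_mono)
    have "K * C / (1 - p) * 1 \<le> K * C / (1 - p) * real (a + b + 1)"
      by (rule mult_left_mono[OF _ KC]) simp
    then show "K * C / (1 - p) \<le> K * C / (1 - p) * real (a + b + 1)" by (simp only: mult_1_right)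
    show "0 \<le> p ^ (a - b)" using p by simp
  qed
  have w2: "K * (C * real (a + b + 1)) / (1 - p) * p ^ (a - b) = K * C / (1 - p) * real (a + b + 1) * p ^ (a - b)" for a
    by simp
  have "1 - P = complex_of_real (1 - p)" by (simp add: P_def)
  then have n1: "norm (1 - P) \<le> 1" using p by (simp only: norm_of_real)
  show "summable (\<lambda>m. green1_coeff P (node m) * poly (invariant_poly P r a b) (node m))"
    "summable (\<lambda>m. green2_coeff P (node m) * poly (invariant_poly P r a b) (node m))"
    "summable (\<lambda>m. green1_coeff P (node m) * poly (euler (invariant_poly P r a b)) (node m))"
    by (rule s1 s2 s3)+
  show "\<exists>C\<ge>0. \<forall>a.
      norm (green1_radial r a b) \<le> C * real (a + b + 1) * p ^ (a - b) \<and>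
      norm (green2_radial r a b) \<le> C * real (a + b + 1) * p ^ (a - b)"
  proof (intro exI[of _ D] conjI allI)
    show "D \<ge> 0" using KC by (simp add: D_def)
    fix a
    show "norm (green1_radial r a b) \<le> D * real (a + b + 1) * p ^ (a - b)"
    proof -
      have "0 \<le> K * C / (1 - p) * real (a + b + 1) * p ^ (a - b)"
        using KC p by (intro mult_nonneg_nonneg) (simp_all only: of_nat_0_le_iff zero_le_power less_imp_le)
      then show ?thesis
        unfolding green1_radial_def norm_minus_cancel D mult_2
        by (intro add_increasing order_trans[OF s1(2) w])
    qed
    define U where "U = (\<Sum>m. green2_coeff P (node m) * poly (invariant_poly P r a b) (node m))"
    define V where "V = (\<Sum>m. green1_coeff P (node m) * poly (euler (invariant_poly P r a b)) (node m))"
    have "norm (green2_radial r a b) \<le> norm U + norm (1 - P) * norm V"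
      unfolding green2_radial_def U_def[symmetric] V_def[symmetric] norm_mult[symmetric]
      by (rule norm_triangle_ineq)
    also have "\<dots> \<le> norm U + 1 * norm V"
      by (intro add_left_mono mult_right_mono n1) simp
    also have "\<dots> \<le> K * C / (1 - p) * p ^ (a - b)
        + 1 * (K * (C * real (a + b + 1)) / (1 - p) * p ^ (a - b))"
      using s2(2)[of a] s3(2)[of a] unfolding U_def V_def by linarith
    also have "\<dots> \<le> D * real (a + b + 1) * p ^ (a - b)"
      unfolding D mult_2 mult_1 w2 by (intro add_right_mono w)
    finally show "norm (green2_radial r a b) \<le> D * real (a + b + 1) * p ^ (a - b)" .
  qed
qed

lemma radial_sums:
  assumes "\<And>a. (\<lambda>m. X m a) sums S a"
  shows "(\<lambda>m. radial P r (X m) a) sums radial P r S a"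
  unfolding radial_def by (intro sums_divide sums_diff sums_mult assms)

text \<open>The start of the telescope contributes nothing because the first node is \<open>P\<close> itself.\<close>

lemma telescoping_sums:
  fixes f :: "complex poly"
  shows "(\<lambda>m. (1 - node m / P) * poly f (node m) - (1 - node m) * poly f (P * node m)) sums (- poly f 0)"
proof -
  define B where "B m = (1 - node m / P) * poly f (node m)" for m
  have "B \<longlonglongrightarrow> (1 - 0 / P) * poly f 0"
    unfolding B_def[abs_def] by (intro tendsto_intros node_tendsto P_nz)
  from telescope_sums'[OF this]
  have "(\<lambda>m. B m - B (Suc m)) sums (B 0 - poly f 0)" by simp
  moreover have "B 0 = 0" using P_nz by (simp add: B_def node_def)
  moreover have "B m - B (Suc m) = (1 - node m / P) * poly f (node m) - (1 - node m) * poly f (P * node m)" for m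
    using P_nz by (simp add: B_def node_def)
  ultimately show ?thesis by simp
qed

lemma radial_green1:
  "radial P r (\<lambda>a. green1_radial r a b) a =
     (if a = b then P ^ b / (\<Prod>i=1..r. 1 - P ^ (i + b)) else 0) / (1 - P)"
proof -
  let ?g = "\<lambda>a. invariant_poly P r a b"
  have lin: "green1_coeff P x * radial P r (\<lambda>a. poly (?g a) x) a =
      radial P r (\<lambda>a. green1_coeff P x * poly (?g a) x) a" for x
    by (simp add: radial_def algebra_simps)
  have "(\<lambda>m. green1_coeff P (node m) * poly (?g a) (node m)) sums (- green1_radial r a b)" for a
    using summable_sums[OF green1_summable] by (simp add: green1_radial_def)
  from radial_sums[OF this]
  have "(\<lambda>m. green1_coeff P (node m) * radial P r (\<lambda>a. poly (?g a) (node m)) a) sums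
      radial P r (\<lambda>a. - green1_radial r a b) a"
    unfolding lin .
  then have "(\<lambda>m. ((1 - node m / P) * poly (?g a) (node m)
      - (1 - node m) * poly (?g a) (P * node m)) / (1 - P)) sums radial P r (\<lambda>a. - green1_radial r a b) a"
    unfolding radial_green1_term[OF P_nz norm_P node_nz node_ne_1] .
  from sums_unique2[OF this sums_divide[OF telescoping_sums]]
  have "radial P r (\<lambda>a. - green1_radial r a b) a = - poly (?g a) 0 / (1 - P)" .
  moreover have "radial P r (\<lambda>a. - green1_radial r a b) a = - radial P r (\<lambda>a. green1_radial r a b) a"
    by (simp add: radial_def algebra_simps diff_divide_distrib add_divide_distrib)
  ultimately show ?thesis
    unfolding poly_invariant_poly_0[OF P_nz norm_P, symmetric] by (metis minus_divide_left neg_equal_iff_equal)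
qed

lemma radial_green2:
  "radial P r (\<lambda>a. green2_radial r a b) a = green1_radial r a b"
proof -
  let ?g = "\<lambda>a. invariant_poly P r a b"
  let ?X = "\<lambda>m a. green2_coeff P (node m) * poly (?g a) (node m)
     + (1 - P) * (green1_coeff P (node m) * poly (euler (?g a)) (node m))"
  note s = green1_summable[of r _ b] green2_summable[of r _ b] green1_euler_summable[of r _ b]
  have "(\<lambda>m. ?X m a) sums green2_radial r a b" for a
    unfolding green2_radial_def by (intro sums_add sums_mult summable_sums s)
  from radial_sums[OF this]
  have 1: "(\<lambda>m. radial P r (?X m) a) sums radial P r (\<lambda>a. green2_radial r a b) a" .
  have 2: "radial P r (?X m) a = - (green1_coeff P (node m) * poly (?g a) (node m))
     + ((1 - node m / P) * poly (euler (?g a)) (node m)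
        - (1 - node m) * poly (euler (?g a)) (P * node m))" for m
    unfolding mult_minus_left[symmetric] radial_green2_term[OF P_nz norm_P node_nz node_ne_1, symmetric]
    by (simp add: radial_def algebra_simps diff_divide_distrib add_divide_distrib)
  have "(\<lambda>m. radial P r (?X m) a) sums (green1_radial r a b + - poly (euler (?g a)) 0)"
    unfolding 2 green1_radial_def
    by (intro sums_add sums_minus telescoping_sums summable_sums s)
  from sums_unique2[OF 1 this] show ?thesis by (simp add: poly_euler)
qed

end

section \<open>The invariant kernels on the quantum disc\<close>

lemma infsum_singleton:
  fixes g :: "'a \<Rightarrow> complex"
  assumes "\<And>x. x \<noteq> x0 \<Longrightarrow> g x = 0"
  shows "infsum g UNIV = g x0"
proof -
  have "infsum g UNIV = infsum g {x0}"
    by (rule infsum_cong_neutral) (use assms in auto)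
  then show ?thesis by simp
qed

locale quantum_disc =
  fixes q :: real and p :: real and P :: complex
  assumes q: "0 < q" "q < 1" and p_q: "p = q\<^sup>2" and P_p: "P = complex_of_real p"
begin

sublocale unit_ratio p P
proof
  show "p < 1" unfolding p_q using q by (simp add: power_less_one_iff)
qed (use q in \<open>auto simp: p_q P_p\<close>)

lemma q_power: "q ^ (2 * n) = p ^ n"
  by (simp add: p_q power_mult)

lemma of_real_p_power: "complex_of_real (p ^ n) = P ^ n"
  by (simp add: P_p)

lemma qpoch_eq: "qpoch q x n = poly (qpoch_poly P n) x"
  by (simp add: qpoch_def poly_qpoch_poly q_power P_p)

lemma ypow_eq: "ypow q l j = (complex_of_real q powr (2 * l)) ^ j"
proof -
  have "complex_of_real q powr (2 * of_nat j * l) = exp (of_nat j * (2 * l * Ln (complex_of_real q)))"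
    using q by (simp add: powr_def mult_ac)
  also have "\<dots> = exp (2 * l * Ln (complex_of_real q)) ^ j" by (rule exp_of_nat_mult)
  finally show ?thesis using q by (simp add: ypow_def powr_def)
qed

lemma word_degree: "k \<noteq> int a - int b \<Longrightarrow> word q a \<phi> b k j = 0"
  by (simp add: word_def)

lemma word_ypow:
  assumes "k = int a - int b"
  shows "word q a (ypow q l) b k j =
    falling P (min a b) j * (complex_of_real q powr (2 * l)) ^ (j - min a b)"
proof -
  have "complex_of_real (\<Prod>i<min a b. 1 - q ^ (2 * j) / q ^ (2 * i)) = falling P (min a b) j"
    by (simp add: falling_def q_power P_p)
  moreover have "falling P (min a b) j = 0" if "\<not> min a b \<le> j"
    by (rule falling_eq_0[OF P_nz]) (use that in linarith)
  ultimately show ?thesis using assms by (simp add: word_def Let_def ypow_eq mult_ac)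
qed

text \<open>The asymmetry between positive and negative degrees in \<open>G\<^sub>l\<close>, which comes from its factor \<open>q\<^bsup>2k\<^esup>\<close>;
  it cancels against the same power in the density of the integral.\<close>

definition degree_factor :: "int \<Rightarrow> complex" where
  "degree_factor i = (if i < 0 then P ^ nat (- i) else 1)"

text \<open>A term \<open>(k, n)\<close> contributes only if \<open>n - k = i\<close>, so the double series runs over \<open>c = min k n\<close>, and only
  \<open>c \<le> b\<close> matters because \<open>\<zeta>\<^sup>c \<eta>\<^sup>l \<zeta>*\<^sup>c\<close> vanishes at \<open>p\<^sup>b\<close> for larger \<open>c\<close>.\<close>

lemma kernel_G_eq:
  "kernel_G q l i j a b = (if j = - i then degree_factor i *
     poly (invariant_poly P (nat \<bar>i\<bar>) a b) (complex_of_real q powr (2 * l)) else 0)"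
proof -
  define x where "x = complex_of_real q powr (2 * l)"
  define t where "t = (\<lambda>(k, n). complex_of_real (q ^ (2 * k)) *
     (qpoch q x k * qpoch q x n) / (qpoch q (complex_of_real (q\<^sup>2)) k * qpoch q (complex_of_real (q\<^sup>2)) n) *
     tensor (word q n (ypow q l) k) (word q k (ypow q l) n) i j a b)"
  have G: "kernel_G q l i j a b = infsum t UNIV"
    by (simp add: kernel_G_def t_def x_def)
  have P_q: "complex_of_real (q\<^sup>2) = P" by (simp add: P_p p_q)
  have t: "t (k, n) = P ^ k * (poly (qpoch_poly P k) x * poly (qpoch_poly P n) x)
     / (poly (qpoch_poly P k) P * poly (qpoch_poly P n) P)
     * (word q n (ypow q l) k i a * word q k (ypow q l) n j b)" for k n
    unfolding t_def tensor_def by (simp only: prod.case q_power of_real_p_power P_q qpoch_eq)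
  show ?thesis
  proof (cases "j = - i")
    case False
    have "t kn = 0" for kn
      using False by (cases kn) (auto simp: t_def tensor_def word_def)
    then have "infsum t UNIV = 0" by (simp add: infsum_0)
    then show ?thesis using False by (simp add: G)
  next
    case True
    define r where "r = nat \<bar>i\<bar>"
    \<comment> \<open>The pair \<open>(k, n)\<close> with \<open>min k n = c\<close> and \<open>n - k = i\<close>.\<close>
    define e where "e c = (if i < 0 then (c + r, c) else (c, c + r))" for c
    have e_inj: "inj_on e {..b}" by (auto simp: e_def inj_on_def split: if_splits)
    have off: "t kn = 0" if "kn \<notin> e ` {..b}" for kn
    proof (rule ccontr)
      assume nz: "t kn \<noteq> 0"
      obtain k n where kn: "kn = (k, n)" by (cases kn)
      have deg: "i = int n - int k" "j = int k - int n"
        using nz by (auto simp: kn t_def tensor_def word_def split: if_splits)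
      have "falling P (min k n) b \<noteq> 0"
        using nz unfolding kn t_def tensor_def by (auto simp: word_ypow[OF deg(2)])
      then have "min k n \<le> b"
        using falling_eq_0[OF P_nz, of b "min k n"] by (meson not_le)
      moreover have "kn = e (min k n)"
        using deg by (auto simp: kn e_def r_def min_def)
      ultimately show False using that by auto
    qed
    have tm: "t (e c) = degree_factor i * (invariant_coeff P r c * falling P c a * falling P c b
        * (x ^ ((a - c) + (b - c)) * (poly (qpoch_poly P c) x * poly (qpoch_poly P (c + r)) x)))" for c
    proof (cases "i < 0")
      case neg: True
      have "word q c (ypow q l) (c + r) i a = falling P c a * x ^ (a - c)"
        "word q (c + r) (ypow q l) c j b = falling P c b * x ^ (b - c)"
        using neg True by (subst word_ypow; simp add: r_def x_def)+
      then show ?thesis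
        using neg by (simp add: t e_def degree_factor_def r_def invariant_coeff_def power_add mult_ac)
    next
      case nonneg: False
      have "word q (c + r) (ypow q l) c i a = falling P c a * x ^ (a - c)"
        "word q c (ypow q l) (c + r) j b = falling P c b * x ^ (b - c)"
        using nonneg True by (subst word_ypow; simp add: r_def x_def)+
      then show ?thesis
        using nonneg by (simp add: t e_def degree_factor_def invariant_coeff_def power_add mult_ac)
    qed
    have "infsum t UNIV = infsum t (e ` {..b})"
      by (rule infsum_cong_neutral) (use off in auto)
    also have "\<dots> = (\<Sum>c\<le>b. t (e c))"
      by (simp add: sum.reindex[OF e_inj])
    also have "\<dots> = degree_factor i * poly (invariant_poly P r a b) x"
      unfolding tm poly_invariant_poly by (simp add: sum_distrib_left)
    finally show ?thesis unfolding G using True by (simp add: r_def x_def)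
  qed
qed

lemma q_powr_nat: "complex_of_real q powr (2 * of_nat N) = P ^ N"
proof -
  have "complex_of_real q powr (2 * of_nat N) = complex_of_real q powr of_nat (2 * N)" by simp
  also have "\<dots> = complex_of_real q ^ (2 * N)" by (rule powr_nat') (use q in simp)
  finally show ?thesis by (simp add: P_p p_q power_mult)
qed

lemma kernel_G_hat_eq:
  "kernel_G_hat q N i j a b = (if j = - i then degree_factor i * complex_of_real (ln p) *
     poly (euler (invariant_poly P (nat \<bar>i\<bar>) a b)) (P ^ N) else 0)"
proof -
  let ?Q = "complex_of_real q"
  define G where "G l = kernel_G q l i j a b" for l
  define D where "D = (if j = - i then degree_factor i * complex_of_real (ln p) *
     poly (euler (invariant_poly P (nat \<bar>i\<bar>) a b)) (P ^ N) else 0)"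
  have "(G has_field_derivative D) (at (of_nat N))"
  proof (cases "j = - i")
    case True
    let ?f = "invariant_poly P (nat \<bar>i\<bar>) a b"
    have "Ln ?Q = complex_of_real (ln q)" using q by (simp add: Ln_of_real)
    moreover have "ln p = 2 * ln q" using q by (simp add: p_q ln_realpow)
    ultimately have ln: "2 * Ln ?Q = complex_of_real (ln p)" by simp
    have "((\<lambda>l. ?Q powr (2 * l)) has_field_derivative
        (Ln ?Q * ?Q powr (2 * of_nat N) * 2)) (at (of_nat N))"
      by (rule DERIV_chain2[OF has_field_derivative_powr_right])
        (use q in \<open>auto intro!: derivative_eq_intros\<close>)
    then have "((\<lambda>l. ?Q powr (2 * l)) has_field_derivative
        (P ^ N * complex_of_real (ln p))) (at (of_nat N))"
      unfolding q_powr_nat ln[symmetric] by (simp add: mult_ac)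
    from DERIV_cmult[OF DERIV_chain2[OF poly_DERIV this], unfolded q_powr_nat, of "degree_factor i"]
    show ?thesis unfolding G_def[abs_def] kernel_G_eq using True
      by (simp add: D_def poly_euler q_powr_nat mult_ac)
  next
    case False
    then show ?thesis unfolding G_def[abs_def] kernel_G_eq by (simp add: D_def)
  qed
  then have "((\<lambda>l. (G l - G (of_nat N)) / (l - of_nat N)) \<longlongrightarrow> D) (at (of_nat N))"
    by (simp add: has_field_derivative_iff)
  from tendsto_Lim[OF _ this] show ?thesis
    by (simp add: kernel_G_hat_def G_def D_def)
qed

lemma green_terms:
  shows "green1_term q (Suc m) i j a b = (if j = - i then degree_factor i *
      (green1_coeff P (node m) * poly (invariant_poly P (nat \<bar>i\<bar>) a b) (node m)) else 0)"
    and "green2_term q (Suc m) i j a b = (if j = - i then degree_factor i *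
      (green2_coeff P (node m) * poly (invariant_poly P (nat \<bar>i\<bar>) a b) (node m)) else 0)"
    and "green2_hat_term q (Suc m) i j a b = (if j = - i then
      degree_factor i * complex_of_real (ln p) *
      (green1_coeff P (node m) * poly (euler (invariant_poly P (nat \<bar>i\<bar>) a b)) (node m)) else 0)"
proof -
  have x: "p ^ Suc m \<noteq> 1" "p ^ Suc m \<noteq> 0"
    using power_Suc_less_one[of p m] p by auto
  have n: "node m = complex_of_real (p ^ Suc m)" unfolding node_def of_real_p_power ..
  have s: "1 / p ^ Suc m - 1 \<noteq> 0" using x by (simp add: field_simps)
  have "(1 / p - 1) / (1 / p ^ Suc m - 1) = (1 - p) / p * (p ^ Suc m / (1 - p ^ Suc m))"
  proof -
    define y where "y = p ^ Suc m"
    have "y \<noteq> 0" "y \<noteq> 1" "p \<noteq> 0" using x p by (auto simp: y_def)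
    then have "(1 / p - 1) / (1 / y - 1) = (1 - p) / p * (y / (1 - y))"
      by (simp add: divide_simps)
    then show ?thesis by (simp add: y_def)
  qed
  then have c1: "complex_of_real ((1 / q\<^sup>2 - 1) / (1 / q ^ (2 * Suc m) - 1)) = green1_coeff P (node m)"
    unfolding q_power p_q[symmetric] green1_coeff_def n by (simp add: P_p)
  have "2 * Suc m - 2 = 2 * m" by simp
  then have c2: "complex_of_real (q ^ (2 * Suc m - 2) * (1 + q ^ (2 * Suc m)) * (1 - q\<^sup>2)\<^sup>2
      / (1 - q ^ (2 * Suc m))\<^sup>2) = green2_coeff P (node m)"
    unfolding p_q[symmetric] green2_coeff_def n using p
    by (simp only: q_power) (simp add: P_p mult_ac)
  have nd: "complex_of_real q powr (2 * of_nat (Suc m)) = node m"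
    unfolding q_powr_nat node_def ..
  show "green1_term q (Suc m) i j a b = (if j = - i then degree_factor i *
      (green1_coeff P (node m) * poly (invariant_poly P (nat \<bar>i\<bar>) a b) (node m)) else 0)"
    unfolding green1_term_def kernel_scale_def c1 kernel_G_eq nd by simp
  show "green2_term q (Suc m) i j a b = (if j = - i then degree_factor i *
      (green2_coeff P (node m) * poly (invariant_poly P (nat \<bar>i\<bar>) a b) (node m)) else 0)"
    unfolding green2_term_def kernel_scale_def c2 kernel_G_eq nd by simp
  show "green2_hat_term q (Suc m) i j a b = (if j = - i then
      degree_factor i * complex_of_real (ln p) *
      (green1_coeff P (node m) * poly (euler (invariant_poly P (nat \<bar>i\<bar>) a b)) (node m)) else 0)"
    unfolding green2_hat_term_def kernel_scale_def c1 kernel_G_hat_eq node_def by simp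
qed

lemma kernel_summable_green:
  "kernel_summable (green1_term q)" "kernel_summable (green2_term q)"
  "kernel_summable (green2_hat_term q)"
proof -
  have "summable (\<lambda>m. if c then f m else 0)" if "summable f" for c and f :: "nat \<Rightarrow> complex"
    using that by (cases c) auto
  then show "kernel_summable (green1_term q)" "kernel_summable (green2_term q)"
    "kernel_summable (green2_hat_term q)"
    unfolding kernel_summable_def green_terms
    by (blast intro: summable_mult green1_summable green2_summable green1_euler_summable)+
qed

lemma green1_eq:
  "green1 q i j a b = (if j = - i then degree_factor i * green1_radial (nat \<bar>i\<bar>) a b else 0)"
  unfolding green1_def kernel_suminf_def green_terms green1_radial_def
  by (simp add: suminf_mult[OF green1_summable])

lemma green2_eq:
  "green2 q i j a b = (if j = - i then degree_factor i * green2_radial (nat \<bar>i\<bar>) a b else 0)"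
proof -
  have h: "ln (1 / p) = - ln p" "ln p \<noteq> 0"
    using p by (auto simp: ln_div)
  show ?thesis
  proof (cases "j = - i")
    case True
    have "(1 - p) / (- ln p) * ln p = - (1 - p)" using h(2) by (simp add: field_simps)
    then have e: "complex_of_real ((1 - p) / (- ln p)) * complex_of_real (ln p) = - (1 - P)"
      by (metis P_p of_real_1 of_real_diff of_real_minus of_real_mult)
    define U where "U = (\<Sum>m. green2_coeff P (node m) * poly (invariant_poly P (nat \<bar>i\<bar>) a b) (node m))"
    define V where "V = (\<Sum>m. green1_coeff P (node m) * poly (euler (invariant_poly P (nat \<bar>i\<bar>) a b)) (node m))"
    have "kernel_suminf (green2_term q) i j a b = degree_factor i * U"
      unfolding kernel_suminf_def green_terms U_def suminf_mult[OF green2_summable, symmetric]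
      using True by simp
    moreover have "kernel_suminf (green2_hat_term q) i j a b = degree_factor i * complex_of_real (ln p) * V"
      unfolding kernel_suminf_def green_terms V_def suminf_mult[OF green1_euler_summable, symmetric]
      using True by simp
    ultimately have "green2 q i j a b = degree_factor i * U
        - complex_of_real ((1 - p) / (- ln p)) * (degree_factor i * complex_of_real (ln p) * V)"
      unfolding green2_def Let_def kernel_scale_def p_q[symmetric] h(1) by (simp only:)
    also have "\<dots> = degree_factor i * U
        - (complex_of_real ((1 - p) / (- ln p)) * complex_of_real (ln p)) * (degree_factor i * V)"
      by (simp only: mult_ac)
    also have "\<dots> = degree_factor i * (U + (1 - P) * V)"
      unfolding e by (simp add: algebra_simps)
    finally show ?thesis using True by (simp add: green2_radial_def U_def V_def)
  next
    case False
    then show ?thesis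
      unfolding green2_def Let_def kernel_suminf_def kernel_scale_def green_terms by simp
  qed
qed

section \<open>The Laplacian on formal series\<close>

lemma word_mult_degree:
  assumes "k \<noteq> int a - int b + int c - int d"
  shows "word_mult q a \<phi> b c \<psi> d k j = 0"
  unfolding word_mult_def Let_def by (rule word_degree) (use assms in linarith)

lemma disc_mult_degree_0:
  assumes "\<And>m. m \<noteq> 0 \<Longrightarrow> F m = (\<lambda>_. 0)"
  shows "disc_mult q F g k j = F 0 (j + nat k) * g k j"
proof -
  have "disc_mult q F g k j = infsum (\<lambda>(m, n).
      word_mult q (nat m) (F m) (nat (- m)) (nat n) (g n) (nat (- n)) k j) UNIV"
    by (simp add: disc_mult_def)
  also have "\<dots> = (\<lambda>(m, n).
      word_mult q (nat m) (F m) (nat (- m)) (nat n) (g n) (nat (- n)) k j) (0, k)"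
  proof (rule infsum_singleton)
    fix mn :: "int \<times> int" assume "mn \<noteq> (0, k)"
    moreover obtain m n where mn: "mn = (m, n)" by (cases mn)
    ultimately have "m \<noteq> 0 \<or> n \<noteq> k" by auto
    moreover have "word_mult q (nat m) (F m) (nat (- m)) (nat n) (g n) (nat (- n)) k j = 0"
      if "m \<noteq> 0"
      using assms[OF that] by (simp add: word_mult_def word_def Let_def)
    moreover have "word_mult q (nat m) (F m) (nat (- m)) (nat n) (g n) (nat (- n)) k j = 0"
      if "m = 0" "n \<noteq> k"
      by (rule word_mult_degree) (use that in linarith)
    ultimately show "(\<lambda>(m, n). word_mult q (nat m) (F m) (nat (- m)) (nat n) (g n) (nat (- n)) k j) mn = 0"
      unfolding mn prod.case by blast
  qed
  also have "\<dots> = F 0 (j + nat k) * g k j"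
    by (cases "k \<ge> 0") (auto simp: word_mult_def word_def Let_def)
  finally show ?thesis .
qed

lemma disc_y_squared:
  "disc_mult q (disc_y q) (disc_y q) k j = (if k = 0 then P ^ (2 * j) else 0)"
proof -
  have y: "disc_y q k j = (if k = 0 then P ^ j else 0)" for k j
    by (simp add: disc_y_def word_def q_power of_real_p_power del: of_real_power)
  have "disc_mult q (disc_y q) (disc_y q) k j = disc_y q 0 (j + nat k) * disc_y q k j"
    by (rule disc_mult_degree_0) (simp add: y fun_eq_iff)
  then show ?thesis by (simp add: y power_mult mult_2 power_add)
qed

lemma qdiff_eq: "qdiff q \<psi> j = (\<psi> j - \<psi> (Suc j)) / (P ^ j * (1 - P))"
proof -
  have "complex_of_real (q ^ (2 * j) - q\<^sup>2 * q ^ (2 * j)) = P ^ j * (1 - P)"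
    unfolding q_power p_q[symmetric] by (simp add: P_p algebra_simps)
  then show ?thesis by (simp only: qdiff_def)
qed

lemma disc_dz_single:
  "disc_dz q f k j =
     (if 0 \<le> k + 1 then dz_pos q (nat (k + 1)) (f (k + 1)) else dz_neg q (nat (- (k + 1))) (f (k + 1))) k j"
  unfolding disc_dz_def
proof (rule infsum_singleton)
  fix m assume m: "m \<noteq> k + 1"
  show "(if 0 \<le> m then dz_pos q (nat m) (f m) else dz_neg q (nat (- m)) (f m)) k j = 0"
  proof (cases "0 \<le> m")
    case True
    then show ?thesis using m by (cases "m = 0") (auto simp: dz_pos_def word_def)
  next
    case False
    then show ?thesis using m by (auto simp: dz_neg_def word_def)
  qed
qed

lemma disc_dzstar_single:
  "disc_dzstar q f k j =
     (if 0 \<le> k - 1 then dzstar_pos q (nat (k - 1)) (f (k - 1)) else dzstar_neg q (nat (- (k - 1))) (f (k - 1))) k j"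
  unfolding disc_dzstar_def
proof (rule infsum_singleton)
  fix m assume m: "m \<noteq> k - 1"
  show "(if 0 \<le> m then dzstar_pos q (nat m) (f m) else dzstar_neg q (nat (- m)) (f m)) k j = 0"
    using m by (auto simp: dzstar_pos_def dzstar_neg_def word_def)
qed

lemma word_one:
  assumes "k = int a - int b" "min a b = 1"
  shows "word q a \<phi> b k j = (if j = 0 then 0 else \<phi> (j - 1) * (1 - P ^ j))"
  using assms by (auto simp: word_def q_power P_p)

lemma disc_dz_nonneg:
  assumes "k \<ge> 0"
  shows "disc_dz q f k j = (1 - 1 / P ^ (nat k + 1)) / (1 - 1 / P) * f (k + 1) j
     - 1 / P ^ (nat k + 1) * (if j = 0 then 0 else qdiff q (f (k + 1)) (j - 1) * (1 - P ^ j))"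
proof -
  have n: "nat (k + 1) = nat k + 1" using assms by simp
  have 1: "word q (nat k) \<phi> 0 k j = \<phi> j" for \<phi>
    using assms by (simp add: word_def)
  have 2: "word q (nat k + 1) \<phi> 1 k j = (if j = 0 then 0 else \<phi> (j - 1) * (1 - P ^ j))" for \<phi>
    by (rule word_one) (use assms in auto)
  have 3: "complex_of_real ((1 - 1 / q ^ (2 * (nat k + 1))) / (1 - 1 / q\<^sup>2)) = (1 - 1 / P ^ (nat k + 1)) / (1 - 1 / P)"
    unfolding q_power p_q[symmetric] by (simp add: P_p)
  have 4: "complex_of_real (1 / q ^ (2 * (nat k + 1))) = 1 / P ^ (nat k + 1)"
    unfolding q_power by (simp add: P_p)
  have "disc_dz q f k j = dz_pos q (nat k + 1) (f (k + 1)) k j"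
    unfolding disc_dz_single n using assms by simp
  then show ?thesis
    unfolding dz_pos_def 3 4 2 by (simp add: 1)
qed

lemma disc_dz_neg:
  assumes "k < 0"
  shows "disc_dz q f k j = - qdiff q (f (k + 1)) j"
proof (cases "k = - 1")
  case True
  then show ?thesis unfolding disc_dz_single by (simp add: dz_pos_def word_def)
next
  case False
  then show ?thesis using assms unfolding disc_dz_single by (simp add: dz_neg_def word_def)
qed

lemma disc_dzstar_pos:
  assumes "k > 0"
  shows "disc_dzstar q f k j = - (1 / P ^ nat k) * qdiff q (f (k - 1)) j"
proof -
  have n: "2 * nat (k - 1) + 2 = 2 * nat k" "nat (k - 1) + 1 = nat k" using assms by auto
  have "complex_of_real (1 / q ^ (2 * nat k)) = 1 / P ^ nat k"
    unfolding q_power by (simp add: P_p)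
  moreover have "word q (nat k) \<phi> 0 k j = \<phi> j" for \<phi>
    using assms by (simp add: word_def)
  ultimately show ?thesis unfolding disc_dzstar_single dzstar_pos_def n using assms by simp
qed

lemma disc_dzstar_nonpos:
  assumes "k \<le> 0"
  shows "disc_dzstar q f k j = - (1 / P) * (if j = 0 then 0 else qdiff q (f (k - 1)) (j - 1) * (1 - P ^ j))
     + (1 - P ^ (nat (- k) + 1)) / (1 - P) * f (k - 1) j"
proof -
  have n: "nat (- (k - 1)) = nat (- k) + 1" using assms by simp
  have 1: "word q 0 \<phi> (nat (- k)) k j = \<phi> j" for \<phi>
    using assms by (simp add: word_def)
  have 2: "word q 1 \<phi> (nat (- k) + 1) k j = (if j = 0 then 0 else \<phi> (j - 1) * (1 - P ^ j))" for \<phi>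
    by (rule word_one) (use assms in auto)
  have 3: "complex_of_real ((1 - q ^ (2 * (nat (- k) + 1))) / (1 - q\<^sup>2)) = (1 - P ^ (nat (- k) + 1)) / (1 - P)"
    unfolding q_power p_q[symmetric] by (simp add: P_p)
  have 4: "complex_of_real (1 / q\<^sup>2) = 1 / P" by (simp add: P_p p_q)
  have "disc_dzstar q f k j = dzstar_neg q (nat (- k) + 1) (f (k - 1)) k j"
    unfolding disc_dzstar_single n using assms by simp
  then show ?thesis
    unfolding dzstar_neg_def 3 4 2 by (simp add: 1)
qed

text \<open>Each of the derivatives shifts the degree by one, so on the coefficient of degree \<open>k\<close> the Laplacian is
  a composition of two first order difference operators.  The two signs of \<open>k\<close> use different formulas
  for the derivatives, but lead to the same second order operator.  The formula holds for all formal series, which is what allows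
  its use on the completion.\<close>

lemma laplacian_eq: "laplacian q f k j = radial P (nat \<bar>k\<bar>) (f k) j"
proof -
  let ?\<psi> = "f k"
  have lap: "laplacian q f k j = P ^ (2 * (j + nat k)) * disc_dzstar q (disc_dz q f) k j"
    unfolding laplacian_def
    by (subst disc_mult_degree_0) (simp_all add: disc_y_squared fun_eq_iff)
  have P1: "1 - P \<noteq> 0" using P_ne_1 by simp
  show ?thesis
  proof (cases "k > 0")
    case True
    define R where "R = P ^ nat k"
    have R: "R \<noteq> 0" using P_nz by (simp add: R_def)
    have n: "nat (k - 1) + 1 = nat k" using True by simp
    have dz: "disc_dz q f (k - 1) j = (1 - 1 / R) / (1 - 1 / P) * ?\<psi> j
      - 1 / R * (if j = 0 then 0 else qdiff q ?\<psi> (j - 1) * (1 - P ^ j))" for j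
      using disc_dz_nonneg[of "k - 1" f j] True by (simp only: n R_def) simp
    have "laplacian q f k j = (P ^ j * R)\<^sup>2 * (- (1 / R) * qdiff q (disc_dz q f (k - 1)) j)"
      unfolding lap disc_dzstar_pos[OF True] by (simp add: R_def power_mult power_add power_mult_distrib mult_2 power2_eq_square mult_ac)
    also have "\<dots> = radial P (nat \<bar>k\<bar>) ?\<psi> j"
    proof (cases j)
      case 0
      show ?thesis unfolding 0 qdiff_eq dz using True P_nz P1 R
        by (simp add: radial_def R_def[symmetric] qdiff_eq power_add)
          (simp add: divide_simps; simp add: algebra_simps power2_eq_square)
    next
      case (Suc i)
      define Y where "Y = P ^ i"
      have Y: "Y \<noteq> 0" using P_nz by (simp add: Y_def)
      have s: "nat \<bar>k\<bar> = nat k" using True by simp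
      show ?thesis unfolding Suc qdiff_eq dz s radial_def using P_nz P1 R Y
        by (simp add: R_def[symmetric] Y_def[symmetric] qdiff_eq power_add)
          (simp add: divide_simps; simp add: algebra_simps power2_eq_square)
    qed
    finally show ?thesis .
  next
    case False
    define R where "R = P ^ nat (- k)"
    have s: "nat \<bar>k\<bar> = nat (- k)" "nat k = 0" using False by auto
    have dz: "disc_dz q f (k - 1) j = - qdiff q ?\<psi> j" for j
      using disc_dz_neg[of "k - 1" f j] False by simp
    have "laplacian q f k j = (P ^ j)\<^sup>2 *
      (- (1 / P) * (if j = 0 then 0 else qdiff q (disc_dz q f (k - 1)) (j - 1) * (1 - P ^ j))
     + (1 - P * R) / (1 - P) * disc_dz q f (k - 1) j)"
      using False unfolding lap s by (subst disc_dzstar_nonpos) (simp_all add: R_def power_mult power2_eq_square mult_2 power_add)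
    also have "\<dots> = radial P (nat \<bar>k\<bar>) ?\<psi> j"
    proof (cases j)
      case 0
      show ?thesis unfolding 0 dz s radial_def using P_nz P1
        by (simp add: R_def[symmetric] qdiff_eq power_add)
          (simp add: divide_simps; simp add: algebra_simps power2_eq_square)
    next
      case (Suc i)
      define Y where "Y = P ^ i"
      have Y: "Y \<noteq> 0" using P_nz by (simp add: Y_def)
      show ?thesis unfolding Suc dz s radial_def using P_nz P1 Y
        by (simp add: R_def[symmetric] Y_def[symmetric] qdiff_eq dz power_add)
          (simp add: divide_simps; simp add: algebra_simps power2_eq_square)
    qed
    finally show ?thesis .
  qed
qed

section \<open>Integral, norm, and boundedness of the Laplacian\<close>

text \<open>The density of the integral on the component of degree \<open>n\<close>: the polynomial
  \<open>z*\<^sup>n z\<^sup>n\<close>, times \<open>q\<^bsup>-2j\<^esup>\<close>; for negative \<open>n\<close> the integrand is moved by \<open>\<bar>n\<bar>\<close> steps, hence the extra power.\<close>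

definition disc_weight :: "int \<Rightarrow> nat \<Rightarrow> real" where
  "disc_weight n j = (\<Prod>i=1..nat \<bar>n\<bar>. 1 - p ^ (i + j)) / (p ^ j * p ^ nat (- n))"

lemma p_power_bounds: "0 < p ^ n" "p ^ n \<le> 1" "0 < n \<Longrightarrow> p ^ n < 1"
  using p by (auto simp: power_le_one power_less_one_iff)

lemma disc_weight_pos: "0 < disc_weight n j"
proof -
  have "0 < (\<Prod>i=1..nat \<bar>n\<bar>. 1 - p ^ (i + j))"
    by (rule prod_pos) (use p_power_bounds(3) in auto)
  then show ?thesis using p by (simp add: disc_weight_def)
qed

text \<open>Detailed balance: the Laplacian is symmetric with respect to this weight.\<close>

lemma disc_weight_Suc:
  "disc_weight n (Suc j) * (p * (1 - p ^ Suc j)) = disc_weight n j * (1 - p ^ (j + 1 + nat \<bar>n\<bar>))"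
proof -
  have "(\<Prod>i=1..r. 1 - p ^ (i + Suc j)) * (1 - p ^ Suc j)
      = (\<Prod>i=1..r. 1 - p ^ (i + j)) * (1 - p ^ (j + 1 + r))" for r
  proof (induction r)
    case (Suc r)
    have "(\<Prod>i=1..Suc r. 1 - p ^ (i + Suc j)) * (1 - p ^ Suc j) =
        ((\<Prod>i=1..r. 1 - p ^ (i + Suc j)) * (1 - p ^ Suc j)) * (1 - p ^ (j + 1 + Suc r))"
      by (simp add: add_ac mult_ac)
    then show ?case unfolding Suc.IH by (simp add: add_ac)
  qed simp
  from this[of "nat \<bar>n\<bar>"] show ?thesis
    using p by (simp add: disc_weight_def divide_simps mult_ac)
qed

lemma disc_weight_bounds:
  obtains c C where "0 < c" "\<And>j. c / p ^ j \<le> disc_weight n j" "\<And>j. disc_weight n j \<le> C / p ^ j"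
proof
  define c0 where "c0 = (\<Prod>i=1..nat \<bar>n\<bar>. 1 - p ^ i)"
  have c0: "0 < c0" unfolding c0_def by (rule prod_pos) (use p_power_bounds(3) in auto)
  show "0 < c0 / p ^ nat (- n)" using c0 p by simp
  fix j
  have "c0 \<le> (\<Prod>i=1..nat \<bar>n\<bar>. 1 - p ^ (i + j))"
    unfolding c0_def
  proof (rule prod_mono)
    fix i
    have "p ^ (i + j) \<le> p ^ i" using p by (intro power_decreasing) auto
    then show "0 \<le> 1 - p ^ i \<and> 1 - p ^ i \<le> 1 - p ^ (i + j)"
      using p_power_bounds(2)[of i] by simp
  qed
  then have "c0 / (p ^ j * p ^ nat (- n)) \<le> disc_weight n j"
    unfolding disc_weight_def using p by (intro divide_right_mono) auto
  then show "c0 / p ^ nat (- n) / p ^ j \<le> disc_weight n j" by (simp add: mult.commute)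
  have "(\<Prod>i=1..nat \<bar>n\<bar>. 1 - p ^ (i + j)) \<le> 1"
    by (rule prod_le_1) (use p_power_bounds(1,2) in \<open>auto intro: less_imp_le\<close>)
  then have "disc_weight n j \<le> 1 / (p ^ j * p ^ nat (- n))"
    unfolding disc_weight_def using p by (intro divide_right_mono) auto
  then show "disc_weight n j \<le> (1 / p ^ nat (- n)) / p ^ j" by (simp add: mult.commute)
qed

text \<open>For \<open>n < 0\<close> the product in normal form is \<open>z\<^sup>r \<phi>(y) \<psi>(y) z*\<^sup>r\<close>, whose value at \<open>b\<close> involves the
  coefficients at \<open>b - r\<close>; shifting the summation index by \<open>r\<close> restores the formula for \<open>n \<ge> 0\<close>.\<close>

lemma word_mult_pairing_sums:
  assumes "\<And>b. B \<le> b \<Longrightarrow> \<psi> b = 0"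
  shows "(\<lambda>b. word_mult q (nat (- n)) \<phi> (nat n) (nat n) \<psi> (nat (- n)) 0 b / complex_of_real (q ^ (2 * b)))
     sums (\<Sum>b<B. \<phi> b * \<psi> b * complex_of_real (disc_weight n b))"
    (is "?T sums ?S")
proof -
  have fin: "(\<lambda>b. \<phi> b * \<psi> b * complex_of_real (disc_weight n b)) sums ?S"
    by (rule sums_finite) (use assms in \<open>auto simp: not_less\<close>)
  show ?thesis
  proof (cases "n \<ge> 0")
    case True
    have "?T b = \<phi> b * \<psi> b * complex_of_real (disc_weight n b)" for b
      using True unfolding word_mult_def word_def Let_def q_power disc_weight_def by simp
    then show ?thesis using fin by simp
  next
    case False
    define r where "r = nat (- n)"
    have r: "nat n = 0" "nat (- n) = r" "nat \<bar>n\<bar> = r" using False by (auto simp: r_def)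
    have T: "?T b = (if r \<le> b then \<phi> (b - r) * \<psi> (b - r) else 0) *
        complex_of_real ((\<Prod>i<r. 1 - p ^ b / p ^ i) / p ^ b)" for b
      unfolding r by (simp add: word_mult_def word_def Let_def q_power)
    have "?T (b + r) = \<phi> b * \<psi> b * complex_of_real (disc_weight n b)" for b
    proof -
      have "(\<Prod>i<r. 1 - p ^ (b + r) / p ^ i) = (\<Prod>i<r. 1 - p ^ (b + (r - i)))"
      proof (intro prod.cong refl)
        fix i assume "i \<in> {..<r}"
        then have "p ^ (b + r) = p ^ (b + (r - i)) * p ^ i"
          unfolding power_add[symmetric] by simp
        then show "1 - p ^ (b + r) / p ^ i = 1 - p ^ (b + (r - i))" using p by simp
      qed
      also have "\<dots> = (\<Prod>i<r. 1 - p ^ (b + (r - (r - Suc i))))"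
        by (rule prod.nat_diff_reindex[symmetric])
      also have "\<dots> = (\<Prod>i<r. 1 - p ^ (Suc i + b))"
        by (intro prod.cong refl) (simp add: Suc_diff_Suc add.commute)
      also have "\<dots> = (\<Prod>i=1..r. 1 - p ^ (i + b))"
        using prod.shift_bounds_Suc_ivl[of "\<lambda>i. 1 - p ^ (i + b)" 0 r]
        by (simp add: atLeast0LessThan atLeastLessThanSuc_atLeastAtMost)
      finally show ?thesis unfolding T by (simp add: disc_weight_def r power_add)
    qed
    then have "(\<lambda>b. ?T (b + r)) sums ?S" using fin by simp
    moreover have "?T b = 0" if "b < r" for b using that unfolding T by simp
    ultimately show ?thesis by (subst (asm) sums_zero_iff_shift) auto
  qed
qed

definition box_supported :: "int set \<Rightarrow> nat \<Rightarrow> disc_series \<Rightarrow> bool" where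
  "box_supported S B f \<longleftrightarrow> finite S \<and> (\<forall>n b. f n b \<noteq> 0 \<longrightarrow> n \<in> S \<and> b < B)"

lemma finite_fun_iff_box: "finite_fun f \<longleftrightarrow> (\<exists>S B. box_supported S B f)"
proof
  assume f: "finite_fun f"
  let ?A = "{(m, j). f m j \<noteq> 0}"
  have "box_supported (fst ` ?A) (Suc (Max (insert 0 (snd ` ?A)))) f"
    unfolding box_supported_def
  proof (intro conjI allI impI)
    show "finite (fst ` ?A)" using f by (simp add: finite_fun_def)
    fix n b assume "f n b \<noteq> 0"
    then have A: "(n, b) \<in> ?A" by simp
    then show "n \<in> fst ` ?A" by force
    have "b \<in> insert 0 (snd ` ?A)" using A by force
    then show "b < Suc (Max (insert 0 (snd ` ?A)))"
      using f by (auto simp: finite_fun_def less_Suc_eq_le intro!: Max_ge)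
  qed
  then show "\<exists>S B. box_supported S B f" by blast
next
  assume "\<exists>S B. box_supported S B f"
  then obtain S B where "box_supported S B f" by blast
  then have "{(m, j). f m j \<noteq> 0} \<subseteq> S \<times> {..<B}" "finite (S \<times> {..<B})"
    by (auto simp: box_supported_def)
  then show "finite_fun f" unfolding finite_fun_def by (rule finite_subset)
qed

lemma disc_integral_mult:
  assumes "box_supported S B f"
  shows "disc_integral q (disc_mult q F f) =
     (1 - P) * (\<Sum>n\<in>S. \<Sum>b<B. F (- n) b * f n b * complex_of_real (disc_weight n b))"
proof -
  have S: "finite S" "\<And>n b. n \<notin> S \<Longrightarrow> f n b = 0" "\<And>n b. B \<le> b \<Longrightarrow> f n b = 0"
    using assms unfolding box_supported_def by (auto simp: not_less[symmetric])
  let ?w = "\<lambda>m n b. word_mult q (nat m) (F m) (nat (- m)) (nat n) (f n) (nat (- n)) 0 b"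
  have "disc_mult q F f 0 b = (\<Sum>n\<in>S. ?w (- n) n b)" for b
  proof -
    have "disc_mult q F f 0 b = infsum (\<lambda>(m, n). ?w m n b) UNIV" by (simp add: disc_mult_def)
    also have "\<dots> = infsum (\<lambda>(m, n). ?w m n b) ((\<lambda>n. (- n, n)) ` S)"
    proof (rule infsum_cong_neutral)
      fix mn :: "int \<times> int" assume mn: "mn \<in> UNIV - (\<lambda>n. (- n, n)) ` S"
      obtain m n where e: "mn = (m, n)" by (cases mn)
      have "m \<noteq> - n \<or> n \<notin> S" using mn by (auto simp: e)
      moreover have "?w m n b = 0" if "m \<noteq> - n"
        by (rule word_mult_degree) (use that in linarith)
      moreover have "?w m n b = 0" if "n \<notin> S"
        using S(2)[OF that] by (simp add: word_mult_def word_def Let_def)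
      ultimately show "(\<lambda>(m, n). ?w m n b) mn = 0" unfolding e prod.case by blast
    qed auto
    also have "\<dots> = (\<Sum>n\<in>S. ?w (- n) n b)"
      using S(1) by (simp add: sum.reindex inj_on_def)
    finally show ?thesis .
  qed
  then have "(\<lambda>b. disc_mult q F f 0 b / complex_of_real (q ^ (2 * b))) =
     (\<lambda>b. \<Sum>n\<in>S. ?w (- n) n b / complex_of_real (q ^ (2 * b)))"
    by (simp only: sum_divide_distrib)
  moreover have "(\<lambda>b. \<Sum>n\<in>S. ?w (- n) n b / complex_of_real (q ^ (2 * b))) sums
     (\<Sum>n\<in>S. \<Sum>b<B. F (- n) b * f n b * complex_of_real (disc_weight n b))"
  proof (rule sums_sum)
    fix n
    show "(\<lambda>b. ?w (- n) n b / complex_of_real (q ^ (2 * b))) sums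
        (\<Sum>b<B. F (- n) b * f n b * complex_of_real (disc_weight n b))"
      using word_mult_pairing_sums[where n = n and \<phi> = "F (- n)", OF S(3)] by simp
  qed
  ultimately have "(\<lambda>b. disc_mult q F f 0 b / complex_of_real (q ^ (2 * b))) sums
     (\<Sum>n\<in>S. \<Sum>b<B. F (- n) b * f n b * complex_of_real (disc_weight n b))" by (simp only:)
  moreover have "complex_of_real (1 - q\<^sup>2) = 1 - P" by (simp add: P_p p_q)
  ultimately show ?thesis unfolding disc_integral_def by (simp only: sums_unique[symmetric])
qed

lemma disc_norm_eq:
  assumes "box_supported S B f"
  shows "disc_norm q f = sqrt ((1 - p) * (\<Sum>n\<in>S. \<Sum>b<B. disc_weight n b * (norm (f n b))\<^sup>2))"
proof -
  have "disc_integral q (disc_mult q (disc_star f) f) =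
     (1 - P) * (\<Sum>n\<in>S. \<Sum>b<B. complex_of_real (disc_weight n b * (norm (f n b))\<^sup>2))"
    unfolding disc_integral_mult[OF assms] disc_star_def minus_minus
    by (simp only: of_real_mult complex_norm_square mult_ac)
  also have "\<dots> = complex_of_real ((1 - p) * (\<Sum>n\<in>S. \<Sum>b<B. disc_weight n b * (norm (f n b))\<^sup>2))"
    by (simp add: P_p)
  finally show ?thesis unfolding disc_norm_def by (simp only: Re_complex_of_real)
qed

text \<open>The coefficients \<open>1 - p\<^bsup>j+1+r\<^esup>\<close> and \<open>p (1 - p\<^sup>j)\<close> lie between 0 and 1, and by \<open>disc_weight_Suc\<close> the weight at
  \<open>j\<close> times either of them is at most the weight at the neighbour that it multiplies.\<close>

lemma radial_norm_bound:
  "(norm (radial P (nat \<bar>n\<bar>) \<psi> j))\<^sup>2 * (1 - p) ^ 4 * disc_weight n j \<le>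
     4 * (disc_weight n (Suc j) * (norm (\<psi> (Suc j)))\<^sup>2 + 2 * (disc_weight n j * (norm (\<psi> j))\<^sup>2)
       + (if j = 0 then 0 else disc_weight n (j - 1) * (norm (\<psi> (j - 1)))\<^sup>2))"
proof -
  define \<alpha> where "\<alpha> = 1 - p ^ (j + 1 + nat \<bar>n\<bar>)"
  define \<beta> where "\<beta> = p * (1 - p ^ j)"
  have \<alpha>: "0 \<le> \<alpha>" "\<alpha> \<le> 1" using p_power_bounds[of "j + 1 + nat \<bar>n\<bar>"] by (auto simp: \<alpha>_def)
  have \<beta>: "0 \<le> \<beta>" "\<beta> \<le> 1"
    using p_power_bounds[of j] p mult_le_one[of p "1 - p ^ j"] by (auto simp: \<beta>_def)
  define u v w where "u = norm (\<psi> (Suc j))" and "v = norm (\<psi> j)" and "w = norm (\<psi> (j - 1))"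
  have nn: "0 \<le> u" "0 \<le> v" "0 \<le> w" by (auto simp: u_def v_def w_def)
  have "1 - P = complex_of_real (1 - p)" by (simp add: P_p)
  then have n1: "norm ((1 - P)\<^sup>2) = (1 - p)\<^sup>2"
    by (simp only: norm_power norm_of_real power2_abs)
  have "(1 - P)\<^sup>2 * radial P (nat \<bar>n\<bar>) \<psi> j =
      complex_of_real \<alpha> * (\<psi> (Suc j) - \<psi> j) - complex_of_real \<beta> * (\<psi> j - \<psi> (j - 1))"
    unfolding radial_numerator[OF P_ne_1] by (simp add: \<alpha>_def \<beta>_def P_p)
  then have "norm (radial P (nat \<bar>n\<bar>) \<psi> j) * (1 - p)\<^sup>2 =
     norm (complex_of_real \<alpha> * (\<psi> (Suc j) - \<psi> j) - complex_of_real \<beta> * (\<psi> j - \<psi> (j - 1)))"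
    by (metis n1 norm_mult mult.commute)
  also have "\<dots> \<le> \<alpha> * (u + v) + \<beta> * (v + w)"
  proof (rule order_trans[OF norm_triangle_ineq4 add_mono])
    show "norm (complex_of_real \<alpha> * (\<psi> (Suc j) - \<psi> j)) \<le> \<alpha> * (u + v)"
      unfolding norm_mult norm_of_real u_def v_def using \<alpha>
      by (auto intro!: mult_left_mono norm_triangle_ineq4)
    show "norm (complex_of_real \<beta> * (\<psi> j - \<psi> (j - 1))) \<le> \<beta> * (v + w)"
      unfolding norm_mult norm_of_real v_def w_def using \<beta>
      by (auto intro!: mult_left_mono norm_triangle_ineq4)
  qed
  finally have le: "norm (radial P (nat \<bar>n\<bar>) \<psi> j) * (1 - p)\<^sup>2 \<le> \<alpha> * (u + v) + \<beta> * (v + w)" .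
  have "(norm (radial P (nat \<bar>n\<bar>) \<psi> j))\<^sup>2 * (1 - p) ^ 4 = (norm (radial P (nat \<bar>n\<bar>) \<psi> j) * (1 - p)\<^sup>2)\<^sup>2"
    by (simp add: power_mult_distrib)
  also have "\<dots> \<le> (\<alpha> * (u + v) + \<beta> * (v + w))\<^sup>2"
    by (rule power_mono[OF le]) simp
  also have "\<dots> \<le> 4 * (\<alpha> * u\<^sup>2 + 2 * v\<^sup>2 + \<beta> * w\<^sup>2)"
  proof -
    have sq: "(x + y)\<^sup>2 \<le> 2 * x\<^sup>2 + 2 * y\<^sup>2" for x y :: real
      using zero_le_power2[of "x - y"] by (simp add: power2_eq_square algebra_simps)
    have c: "(c * (x + y))\<^sup>2 \<le> 2 * (c * (x\<^sup>2 + y\<^sup>2))" if "0 \<le> c" "c \<le> 1" for c x y :: real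
    proof -
      have "(c * (x + y))\<^sup>2 = c * (c * (x + y)\<^sup>2)" by (simp add: power2_eq_square)
      also have "\<dots> \<le> c * (1 * (2 * x\<^sup>2 + 2 * y\<^sup>2))"
        using that by (intro mult_left_mono mult_mono sq) auto
      also have "\<dots> = 2 * (c * (x\<^sup>2 + y\<^sup>2))" by (simp add: algebra_simps)
      finally show ?thesis .
    qed
    have "(\<alpha> * (u + v) + \<beta> * (v + w))\<^sup>2 \<le> 2 * (\<alpha> * (u + v))\<^sup>2 + 2 * (\<beta> * (v + w))\<^sup>2"
      by (rule sq)
    also have "\<dots> \<le> 2 * (2 * (\<alpha> * (u\<^sup>2 + v\<^sup>2))) + 2 * (2 * (\<beta> * (v\<^sup>2 + w\<^sup>2)))"
      by (intro add_mono mult_left_mono c \<alpha> \<beta>) auto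
    also have "\<dots> \<le> 4 * (\<alpha> * u\<^sup>2 + 2 * v\<^sup>2 + \<beta> * w\<^sup>2)"
    proof -
      have "\<alpha> * v\<^sup>2 \<le> 1 * v\<^sup>2" "\<beta> * v\<^sup>2 \<le> 1 * v\<^sup>2" using \<alpha> \<beta> by (intro mult_right_mono; simp)+
      then show ?thesis by (simp add: algebra_simps)
    qed
    finally show ?thesis .
  qed
  finally have "(norm (radial P (nat \<bar>n\<bar>) \<psi> j))\<^sup>2 * (1 - p) ^ 4 * disc_weight n j \<le>
      4 * (\<alpha> * u\<^sup>2 + 2 * v\<^sup>2 + \<beta> * w\<^sup>2) * disc_weight n j"
    by (rule mult_right_mono) (use disc_weight_pos[of n j] in simp)
  also have "\<dots> = 4 * ((disc_weight n j * \<alpha>) * u\<^sup>2 + 2 * (disc_weight n j * v\<^sup>2) + (disc_weight n j * \<beta>) * w\<^sup>2)"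
    by (simp add: algebra_simps)
  also have "\<dots> \<le> 4 * (disc_weight n (Suc j) * u\<^sup>2 + 2 * (disc_weight n j * v\<^sup>2)
      + (if j = 0 then 0 else disc_weight n (j - 1) * w\<^sup>2))"
  proof (intro mult_left_mono add_mono order_refl)
    have "disc_weight n j * \<alpha> = disc_weight n (Suc j) * (p * (1 - p ^ Suc j))"
      unfolding disc_weight_Suc \<alpha>_def ..
    also have "\<dots> \<le> disc_weight n (Suc j) * 1"
      using p p_power_bounds[of "Suc j"] disc_weight_pos[of n "Suc j"]
      by (intro mult_left_mono mult_le_one) auto
    finally show "(disc_weight n j * \<alpha>) * u\<^sup>2 \<le> disc_weight n (Suc j) * u\<^sup>2"
      by (intro mult_right_mono) auto
    show "(disc_weight n j * \<beta>) * w\<^sup>2 \<le> (if j = 0 then 0 else disc_weight n (j - 1) * w\<^sup>2)"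
    proof (cases j)
      case (Suc i)
      have "disc_weight n j * \<beta> = disc_weight n i * (1 - p ^ (i + 1 + nat \<bar>n\<bar>))"
        unfolding Suc \<beta>_def disc_weight_Suc ..
      also have "\<dots> \<le> disc_weight n i * 1"
        using p_power_bounds[of "i + 1 + nat \<bar>n\<bar>"] disc_weight_pos[of n i]
        by (intro mult_left_mono) auto
      finally have "(disc_weight n j * \<beta>) * w\<^sup>2 \<le> disc_weight n i * w\<^sup>2"
        by (intro mult_right_mono) auto
      then show ?thesis by (simp add: Suc)
    qed (simp add: \<beta>_def)
  qed (use disc_weight_pos[of n j] in auto)
  finally show ?thesis unfolding u_def v_def w_def .
qed

lemma box_supported_laplacian:
  assumes "box_supported S B f"
  shows "box_supported S (Suc B) (laplacian q f)"
  unfolding box_supported_def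
proof (intro conjI allI impI)
  show "finite S" using assms by (simp add: box_supported_def)
  fix n b assume "laplacian q f n b \<noteq> 0"
  then have "f n b \<noteq> 0 \<or> f n (Suc b) \<noteq> 0 \<or> f n (b - 1) \<noteq> 0"
    unfolding laplacian_eq radial_def by auto
  then show "n \<in> S" "b < Suc B" using assms unfolding box_supported_def by fastforce+
qed

lemma laplacian_bounded:
  assumes f: "finite_fun f"
  shows "disc_norm q (laplacian q f) \<le> 4 / (1 - p)\<^sup>2 * disc_norm q f"
proof -
  obtain S B where box: "box_supported S B f" using f finite_fun_iff_box by blast
  define h where "h n j = disc_weight n j * (norm (f n j))\<^sup>2" for n j
  have h0: "0 \<le> h n j" for n j using disc_weight_pos[of n j] by (simp add: h_def)
  have hB: "h n j = 0" if "B \<le> j" for n j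
    using box that unfolding box_supported_def h_def by (auto simp: not_less[symmetric])
  have comp: "(\<Sum>j<Suc B. disc_weight n j * (norm (laplacian q f n j))\<^sup>2) * (1 - p) ^ 4 \<le> 16 * (\<Sum>j<B. h n j)" for n
  proof -
    have "(\<Sum>j<Suc B. disc_weight n j * (norm (laplacian q f n j))\<^sup>2) * (1 - p) ^ 4 \<le>
       (\<Sum>j<Suc B. 4 * (h n (Suc j) + 2 * h n j + (if j = 0 then 0 else h n (j - 1))))"
      unfolding sum_distrib_right
    proof (rule sum_mono)
      fix j
      show "disc_weight n j * (norm (laplacian q f n j))\<^sup>2 * (1 - p) ^ 4 \<le>
          4 * (h n (Suc j) + 2 * h n j + (if j = 0 then 0 else h n (j - 1)))"
        using radial_norm_bound[of n "f n" j] unfolding laplacian_eq h_def by (simp only: mult_ac)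
    qed
    also have "\<dots> = 4 * ((\<Sum>j<Suc B. h n (Suc j)) + 2 * (\<Sum>j<Suc B. h n j)
        + (\<Sum>j<Suc B. if j = 0 then 0 else h n (j - 1)))"
      by (simp only: sum.distrib flip: sum_distrib_left)
    also have "(\<Sum>j<Suc B. h n j) = (\<Sum>j<B. h n j)" by (simp add: hB)
    also have "(\<Sum>j<Suc B. if j = 0 then 0 else h n (j - 1)) = (\<Sum>j<B. h n j)"
      unfolding sum.lessThan_Suc_shift by simp
    also have "(\<Sum>j<Suc B. h n (Suc j)) \<le> (\<Sum>j<B. h n j)"
    proof -
      have "h n 0 + (\<Sum>j<Suc B. h n (Suc j)) = (\<Sum>j<Suc (Suc B). h n j)"
        by (rule sum.lessThan_Suc_shift[symmetric])
      also have "\<dots> = (\<Sum>j<B. h n j)" by (simp add: hB)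
      finally show ?thesis using h0[of n 0] by linarith
    qed
    finally show ?thesis by simp
  qed
  define X where "X = (\<Sum>n\<in>S. \<Sum>j<Suc B. disc_weight n j * (norm (laplacian q f n j))\<^sup>2)"
  define Y where "Y = (\<Sum>n\<in>S. \<Sum>j<B. h n j)"
  have "X * (1 - p) ^ 4 \<le> 16 * Y"
    unfolding X_def Y_def sum_distrib_right[where A = S] sum_distrib_left[where A = S]
    by (rule sum_mono) (rule comp)
  then have "X \<le> 16 / (1 - p) ^ 4 * Y"
    using p by (simp add: field_simps)
  then have "(1 - p) * X \<le> (4 / (1 - p)\<^sup>2)\<^sup>2 * ((1 - p) * Y)"
    using p mult_left_mono[of X "16 / (1 - p) ^ 4 * Y" "1 - p"]
    by (simp add: power_divide mult_ac)
  then have "sqrt ((1 - p) * X) \<le> sqrt ((4 / (1 - p)\<^sup>2)\<^sup>2 * ((1 - p) * Y))"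
    by (rule real_sqrt_le_mono)
  also have "\<dots> = 4 / (1 - p)\<^sup>2 * sqrt ((1 - p) * Y)"
    unfolding real_sqrt_mult real_sqrt_abs by simp
  finally show ?thesis
    unfolding disc_norm_eq[OF box] disc_norm_eq[OF box_supported_laplacian[OF box]] X_def Y_def h_def .
qed

section \<open>The Laplacian on square integrable series and its inverse\<close>

lemma laplacian_diff:
  "laplacian q (\<lambda>k j. f k j - g k j) = (\<lambda>k j. laplacian q f k j - laplacian q g k j)"
  by (intro ext) (simp add: laplacian_eq radial_def algebra_simps diff_divide_distrib add_divide_distrib)

lemma finite_fun_diff:
  assumes "finite_fun f" "finite_fun g"
  shows "finite_fun (\<lambda>k j. f k j - g k j)"
proof -
  have "{(m, j). f m j - g m j \<noteq> 0} \<subseteq> {(m, j). f m j \<noteq> 0} \<union> {(m, j). g m j \<noteq> 0}" by auto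
  then show ?thesis using assms unfolding finite_fun_def by (meson finite_UnI finite_subset)
qed

text \<open>Boundedness keeps the approximating sequence Cauchy, and the coefficients converge because
  every coefficient of the image depends on three coefficients of the argument.\<close>

lemma L2_approx_laplacian:
  assumes "L2_approx q s F"
  shows "L2_approx q (\<lambda>n. laplacian q (s n)) (laplacian q F)"
  unfolding L2_approx_def
proof (intro conjI allI impI)
  have fin: "finite_fun (s n)" for n using assms by (simp add: L2_approx_def)
  show "finite_fun (laplacian q (s n))" for n
    using fin[of n] box_supported_laplacian finite_fun_iff_box by blast
  show "(\<lambda>n. laplacian q (s n) k j) \<longlonglongrightarrow> laplacian q F k j" for k j
  proof -
    have lim: "(\<lambda>n. s n k j) \<longlonglongrightarrow> F k j" for k j using assms by (simp add: L2_approx_def)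
    have "(1 - P)\<^sup>2 \<noteq> 0" using P_ne_1 by simp
    then show ?thesis unfolding laplacian_eq radial_def by (intro tendsto_intros lim)
  qed
  fix e :: real assume e: "e > 0"
  define K where "K = 4 / (1 - p)\<^sup>2"
  have K: "K > 0" using p by (simp add: K_def)
  obtain N where N: "\<And>m n. m \<ge> N \<Longrightarrow> n \<ge> N \<Longrightarrow> disc_norm q (\<lambda>k j. s m k j - s n k j) < e / K"
    using assms e K unfolding L2_approx_def by (meson divide_pos_pos)
  show "\<exists>N. \<forall>m\<ge>N. \<forall>n\<ge>N. disc_norm q (\<lambda>k j. laplacian q (s m) k j - laplacian q (s n) k j) < e"
  proof (intro exI[of _ N] allI impI)
    fix m n assume mn: "N \<le> m" "N \<le> n"
    have "disc_norm q (\<lambda>k j. laplacian q (s m) k j - laplacian q (s n) k j)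
        \<le> K * disc_norm q (\<lambda>k j. s m k j - s n k j)"
      unfolding laplacian_diff[symmetric] K_def by (intro laplacian_bounded finite_fun_diff fin)
    also have "\<dots> < K * (e / K)" using N[OF mn] K by (intro mult_strict_left_mono)
    finally show "disc_norm q (\<lambda>k j. laplacian q (s m) k j - laplacian q (s n) k j) < e"
      using K by simp
  qed
qed

lemma laplacian_L2_eq:
  assumes "F \<in> disc_L2 q"
  shows "laplacian_L2 q F = laplacian q F"
  unfolding laplacian_L2_def
proof (rule the_equality)
  obtain s where "L2_approx q s F" using assms by (auto simp: disc_L2_def)
  then show "\<exists>s. L2_approx q s F \<and> L2_approx q (\<lambda>n. laplacian q (s n)) (laplacian q F)"
    using L2_approx_laplacian by blast
  fix H assume "\<exists>s. L2_approx q s F \<and> L2_approx q (\<lambda>n. laplacian q (s n)) H"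
  then obtain s where "L2_approx q s F" and H: "L2_approx q (\<lambda>n. laplacian q (s n)) H" by blast
  from L2_approx_laplacian[OF this(1)]
  have "(\<lambda>n. laplacian q (s n) k j) \<longlonglongrightarrow> laplacian q F k j" for k j by (simp add: L2_approx_def)
  moreover have "(\<lambda>n. laplacian q (s n) k j) \<longlonglongrightarrow> H k j" for k j
    using H by (simp add: L2_approx_def)
  ultimately show "H = laplacian q F" by (intro ext) (rule LIMSEQ_unique)
qed

text \<open>The weight grows like \<open>p\<^sup>-\<^sup>j\<close>.  Far out a term \<open>s N\<close> of the approximating sequence is zero, so
  there the coefficient of \<open>F\<close> is a limit of coefficients of \<open>s m - s N\<close>, which have norm below 1.\<close>

lemma disc_L2_tendsto_0:
  assumes "F \<in> disc_L2 q"
  shows "F n \<longlonglongrightarrow> 0"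
proof -
  obtain s where s: "L2_approx q s F" using assms by (auto simp: disc_L2_def)
  then have fin: "finite_fun (s k)" for k by (simp add: L2_approx_def)
  obtain N where N: "\<And>m. m \<ge> N \<Longrightarrow> disc_norm q (\<lambda>k j. s m k j - s N k j) < 1"
    using s unfolding L2_approx_def by (metis order_refl zero_less_one)
  obtain c C where c: "0 < c" "\<And>j. c / p ^ j \<le> disc_weight n j"
    using disc_weight_bounds by metis
  obtain S B where B: "box_supported S B (s N)" using fin finite_fun_iff_box by blast
  have diff: "(1 - p) * (c / p ^ j) * (norm (s m n j - s N n j))\<^sup>2 \<le> 1" if "m \<ge> N" for m j
  proof (cases "s m n j - s N n j = 0")
    case False
    define d where "d k j = s m k j - s N k j" for k j
    have "finite_fun d" unfolding d_def[abs_def] by (intro finite_fun_diff fin)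
    then obtain S' B' where box: "box_supported S' B' d" using finite_fun_iff_box by blast
    have "n \<in> S'" "j < B'" "finite S'"
      using box False unfolding box_supported_def d_def by auto
    define h where "h k b = disc_weight k b * (norm (d k b))\<^sup>2" for k b
    have h0: "0 \<le> h k b" for k b using disc_weight_pos[of k b] by (simp add: h_def)
    have "sqrt ((1 - p) * (\<Sum>k\<in>S'. \<Sum>b<B'. h k b)) < 1"
      using N[OF that] disc_norm_eq[OF box] unfolding d_def[abs_def, symmetric] h_def by simp
    then have sum1: "(1 - p) * (\<Sum>k\<in>S'. \<Sum>b<B'. h k b) < 1" by simp
    have "c / p ^ j * (norm (d n j))\<^sup>2 \<le> h n j"
      unfolding h_def by (intro mult_right_mono c) simp
    also have "\<dots> \<le> (\<Sum>b<B'. h n b)"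
      by (rule member_le_sum) (use \<open>j < B'\<close> h0 in auto)
    also have "\<dots> \<le> (\<Sum>k\<in>S'. \<Sum>b<B'. h k b)"
      by (rule member_le_sum) (use \<open>n \<in> S'\<close> \<open>finite S'\<close> h0 in \<open>auto intro: sum_nonneg\<close>)
    finally have "(1 - p) * (c / p ^ j * (norm (d n j))\<^sup>2) \<le> (1 - p) * (\<Sum>k\<in>S'. \<Sum>b<B'. h k b)"
      using p by (intro mult_left_mono) auto
    then show ?thesis using sum1 by (simp add: d_def mult.assoc)
  qed simp
  have tail: "(norm (F n j))\<^sup>2 \<le> (1 / ((1 - p) * c)) * p ^ j" if "B \<le> j" for j
  proof -
    have z: "s N n j = 0" using B that by (auto simp: box_supported_def not_less[symmetric])
    have "(\<lambda>m. (1 - p) * (c / p ^ j) * (norm (s m n j - s N n j))\<^sup>2)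
        \<longlonglongrightarrow> (1 - p) * (c / p ^ j) * (norm (F n j - s N n j))\<^sup>2"
      using s by (intro tendsto_intros) (simp add: L2_approx_def)
    then have "(1 - p) * (c / p ^ j) * (norm (F n j - s N n j))\<^sup>2 \<le> 1"
      by (rule LIMSEQ_le_const2) (use diff in blast)
    then show ?thesis using z p c(1) by (simp add: field_simps)
  qed
  have "(\<lambda>j. (1 / ((1 - p) * c)) * p ^ j) \<longlonglongrightarrow> (1 / ((1 - p) * c)) * 0"
    using p by (intro tendsto_intros LIMSEQ_power_zero) simp
  then have "(\<lambda>j. (1 / ((1 - p) * c)) * p ^ j) \<longlonglongrightarrow> 0" by simp
  then have "(\<lambda>j. (norm (F n j))\<^sup>2) \<longlonglongrightarrow> 0"
    by (rule tendsto_sandwich[OF _ _ tendsto_const, rotated 2])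
      (use tail in \<open>auto simp: eventually_sequentially\<close>)
  then have "(\<lambda>j. sqrt ((norm (F n j))\<^sup>2)) \<longlonglongrightarrow> sqrt 0" by (rule tendsto_real_sqrt)
  then show ?thesis by (simp add: tendsto_norm_zero_iff)
qed

text \<open>Since the coefficient of \<open>\<psi>(j-1)\<close> vanishes at \<open>j = 0\<close>, the recursion \<open>L \<psi> = 0\<close> propagates
  \<open>\<psi>(1) = \<psi>(0)\<close> to all \<open>j\<close>: the harmonic series in one degree are the multiples of \<open>z\<^sup>i\<close> or \<open>z*\<^sup>i\<close>, which
  are not square integrable.\<close>

lemma inj_on_laplacian_L2: "inj_on (laplacian_L2 q) (disc_L2 q)"
proof (rule inj_onI)
  fix F G assume F: "F \<in> disc_L2 q" and G: "G \<in> disc_L2 q" and eq: "laplacian_L2 q F = laplacian_L2 q G"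
  define D where "D = (\<lambda>k j. F k j - G k j)"
  have "laplacian q F = laplacian q G" using eq laplacian_L2_eq F G by simp
  then have "laplacian q D k j = 0" for k j unfolding D_def laplacian_diff by simp
  then have rad: "(1 - P)\<^sup>2 * radial P (nat \<bar>k\<bar>) (D k) j = 0" for k j
    unfolding laplacian_eq by simp
  have const: "D k (Suc j) = D k j" for k j
  proof (induction j)
    case 0
    have "1 - P ^ (0 + 1 + nat \<bar>k\<bar>) \<noteq> 0"
      using p_power_bounds(3)[of "0 + 1 + nat \<bar>k\<bar>"] by (metis P_p add_gr_0 eq_iff_diff_eq_0 less_irrefl
          of_real_eq_1_iff of_real_power zero_less_one)
    then show ?case using rad[of k 0] unfolding radial_numerator[OF P_ne_1] by simp
  next
    case (Suc j)
    have "1 - P ^ (Suc j + 1 + nat \<bar>k\<bar>) \<noteq> 0"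
      using p_power_bounds(3)[of "Suc j + 1 + nat \<bar>k\<bar>"] by (metis P_p add_gr_0 eq_iff_diff_eq_0 less_irrefl
          of_real_eq_1_iff of_real_power zero_less_one)
    then show ?case using rad[of k "Suc j"] Suc unfolding radial_numerator[OF P_ne_1] by simp
  qed
  have "D k j = 0" for k j
  proof -
    have D0: "D k i = D k 0" for i by (induction i) (simp_all add: const)
    have "D k \<longlonglongrightarrow> 0 - 0"
      unfolding D_def by (intro tendsto_diff disc_L2_tendsto_0 F G)
    then have "(\<lambda>i. D k 0) \<longlonglongrightarrow> 0" using D0 by (metis (no_types, lifting) ext diff_zero)
    then have "D k 0 = 0" by (simp add: LIMSEQ_const_iff)
    then show ?thesis using D0[of j] by simp
  qed
  then show "F = G" by (intro ext) (simp add: D_def)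
qed

lemma laplacian_inv_eqI:
  assumes "F \<in> disc_L2 q" "laplacian q F = H"
  shows "laplacian_inv q H = F"
  unfolding laplacian_inv_def
  by (rule the_inv_into_f_eq[OF inj_on_laplacian_L2]) (use assms laplacian_L2_eq in auto)

text \<open>The truncations of \<open>F\<close> to \<open>j < N\<close> form an approximating sequence: the squared norm of a
  difference of two of them is a difference of partial sums of a convergent series.\<close>

lemma disc_L2I:
  assumes S: "finite S" "\<And>n. n \<notin> S \<Longrightarrow> F n = (\<lambda>_. 0)"
    and sm: "\<And>n. summable (\<lambda>j. (norm (F n j))\<^sup>2 / p ^ j)"
  shows "F \<in> disc_L2 q"
proof -
  have supp: "n \<in> S" if "F n j \<noteq> 0" for n j
  proof (rule ccontr)
    assume "n \<notin> S"
    from S(2)[OF this] that show False by simp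
  qed
  define s where "s N = (\<lambda>n j. if j < N then F n j else 0)" for N
  define h where "h n j = disc_weight n j * (norm (F n j))\<^sup>2" for n j
  have h0: "0 \<le> h n j" for n j using disc_weight_pos[of n j] by (simp add: h_def)
  define T where "T N = (\<Sum>n\<in>S. \<Sum>j<N. h n j)" for N
  have sh: "summable (h n)" for n
  proof -
    obtain c C where C: "\<And>j. disc_weight n j \<le> C / p ^ j" using disc_weight_bounds by metis
    show ?thesis
    proof (rule summable_comparison_test')
      show "summable (\<lambda>j. C * ((norm (F n j))\<^sup>2 / p ^ j))" by (rule summable_mult[OF sm])
      fix j
      have "h n j \<le> C / p ^ j * (norm (F n j))\<^sup>2" unfolding h_def by (intro mult_right_mono C) simp
      then show "norm (h n j) \<le> C * ((norm (F n j))\<^sup>2 / p ^ j)" using h0[of n j] by simp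
    qed
  qed
  have "T \<longlonglongrightarrow> (\<Sum>n\<in>S. suminf (h n))"
    unfolding T_def[abs_def] by (intro tendsto_sum summable_LIMSEQ sh)
  then have "Cauchy T" by (rule LIMSEQ_imp_Cauchy)
  have norm_le: "disc_norm q (\<lambda>k j. s m k j - s n k j) = sqrt ((1 - p) * (T m - T n))" if "n \<le> m" for m n
  proof -
    have box: "box_supported S m (\<lambda>k j. s m k j - s n k j)"
      using S(1) supp that unfolding box_supported_def s_def by (auto split: if_splits)
    have "(\<Sum>j<m. disc_weight k j * (norm (s m k j - s n k j))\<^sup>2) = (\<Sum>j<m. h k j) - (\<Sum>j<n. h k j)" for k
    proof -
      have "(\<Sum>j<m. h k j) = (\<Sum>j<n. h k j) + (\<Sum>j=n..<m. h k j)"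
        using that by (metis atLeast0LessThan sum.atLeastLessThan_concat zero_le)
      moreover have "(\<Sum>j<m. disc_weight k j * (norm (s m k j - s n k j))\<^sup>2) = (\<Sum>j=n..<m. h k j)"
        by (rule sum.mono_neutral_cong_right) (use that in \<open>auto simp: s_def h_def\<close>)
      ultimately show ?thesis by simp
    qed
    then show ?thesis unfolding disc_norm_eq[OF box] T_def by (simp add: sum_subtractf)
  qed
  have symm: "disc_norm q (\<lambda>k j. s m k j - s n k j) = disc_norm q (\<lambda>k j. s n k j - s m k j)" for m n
  proof -
    have box: "box_supported S (max m n) (\<lambda>k j. s m k j - s n k j)"
      "box_supported S (max m n) (\<lambda>k j. s n k j - s m k j)"
      using S(1) supp unfolding box_supported_def s_def by (auto split: if_splits)
    show ?thesis unfolding disc_norm_eq[OF box(1)] disc_norm_eq[OF box(2)] by (simp add: norm_minus_commute)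
  qed
  have "L2_approx q s F"
    unfolding L2_approx_def
  proof (intro conjI allI impI)
    fix N
    have "box_supported S N (s N)" using S(1) supp by (auto simp: box_supported_def s_def split: if_splits)
    then show "finite_fun (s N)" using finite_fun_iff_box by blast
  next
    fix k j
    show "(\<lambda>n. s n k j) \<longlonglongrightarrow> F k j"
      by (rule tendsto_eventually) (auto simp: eventually_sequentially s_def intro!: exI[of _ "Suc j"])
  next
    fix e :: real assume e: "e > 0"
    from \<open>Cauchy T\<close> obtain M where M: "\<And>m n. m \<ge> M \<Longrightarrow> n \<ge> M \<Longrightarrow> norm (T m - T n) < e\<^sup>2"
      using e unfolding Cauchy_iff by (meson zero_less_power)
    have main: "disc_norm q (\<lambda>k j. s m k j - s n k j) < e" if "M \<le> n" "n \<le> m" for m n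
    proof -
      have "(1 - p) * (T m - T n) \<le> 1 * norm (T m - T n)"
      proof (cases "T m - T n \<ge> 0")
        case True
        then show ?thesis using p by (intro mult_mono) auto
      next
        case False
        then have "(1 - p) * (T m - T n) \<le> 0" using p by (intro mult_nonneg_nonpos) auto
        then show ?thesis by (smt (verit) norm_ge_zero)
      qed
      also have "\<dots> < e\<^sup>2" using M[of m n] that by simp
      finally have "sqrt ((1 - p) * (T m - T n)) < sqrt (e\<^sup>2)" by (rule real_sqrt_less_mono)
      then show ?thesis unfolding norm_le[OF that(2)] using e by simp
    qed
    show "\<exists>N. \<forall>m\<ge>N. \<forall>n\<ge>N. disc_norm q (\<lambda>k j. s m k j - s n k j) < e"
    proof (intro exI[of _ M] allI impI)
      fix m n assume "M \<le> m" "M \<le> n"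
      then show "disc_norm q (\<lambda>k j. s m k j - s n k j) < e"
        using main[of n m] main[of m n] symm[of m n] by (cases "n \<le> m") auto
    qed
  qed
  then show ?thesis unfolding disc_L2_def by blast
qed

text \<open>The series is dominated by \<open>\<Sum> (j+1) (j+2) p\<^sup>j\<close>, the second derivative of the geometric series.\<close>

lemma summable_linear_decay:
  assumes "\<And>j. norm (\<psi> j :: complex) \<le> C * (real (j + 1) * p ^ j)"
  shows "summable (\<lambda>j. (norm (\<psi> j))\<^sup>2 / p ^ j)"
proof -
  have geo: "summable (\<lambda>n. 1 * x ^ n)" if "norm x < 1" for x :: real
    using summable_geometric[OF that] by simp
  have "summable (\<lambda>n. diffs (\<lambda>n. 1) n * x ^ n)" if "norm x < 1" for x :: real
    by (rule termdiff_converges[OF that geo])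
  from termdiff_converges[OF _ this, of p 1]
  have s: "summable (\<lambda>n. diffs (diffs (\<lambda>n. 1)) n * p ^ n)" using p by simp
  show ?thesis
  proof (rule summable_comparison_test')
    show "summable (\<lambda>j. C\<^sup>2 * (diffs (diffs (\<lambda>n. 1)) j * p ^ j))" by (rule summable_mult[OF s])
    fix j
    have "(norm (\<psi> j))\<^sup>2 / p ^ j \<le> (C * (real (j + 1) * p ^ j))\<^sup>2 / p ^ j"
      using p by (intro divide_right_mono power_mono assms) auto
    also have "\<dots> = C\<^sup>2 * ((real (j + 1))\<^sup>2 * p ^ j)"
      using p by (simp add: power_mult_distrib power2_eq_square)
    also have "\<dots> \<le> C\<^sup>2 * (diffs (diffs (\<lambda>n. 1)) j * p ^ j)"
      using p by (intro mult_left_mono mult_right_mono)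
        (auto simp: diffs_def power2_eq_square algebra_simps)
    finally show "norm ((norm (\<psi> j))\<^sup>2 / p ^ j) \<le> C\<^sup>2 * (diffs (diffs (\<lambda>n. 1)) j * p ^ j)"
      using p by simp
  qed
qed

text \<open>By degree reasons only the component of \<open>f\<close> of degree \<open>i\<close> meets the component \<open>(i, - i)\<close> of \<open>K\<close>, and
  \<open>degree_factor\<close> cancels the extra power in the weight.\<close>

lemma kernel_integral_radial:
  assumes K: "\<And>i j a b. K i j a b = (if j = - i then degree_factor i * g (nat \<bar>i\<bar>) a b else 0)"
    and box: "box_supported S B f"
  shows "kernel_integral q K f i a = (\<Sum>b<B.
    ((1 - P) * (f i b * ((\<Prod>m=1..nat \<bar>i\<bar>. 1 - P ^ (m + b)) / P ^ b))) * g (nat \<bar>i\<bar>) a b)"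
proof -
  have w: "degree_factor n * complex_of_real (disc_weight n b) =
      (\<Prod>m=1..nat \<bar>n\<bar>. 1 - P ^ (m + b)) / P ^ b" for n b
    unfolding degree_factor_def disc_weight_def using P_nz by (simp add: P_p)
  define t where "t b = f i b * ((\<Prod>m=1..nat \<bar>i\<bar>. 1 - P ^ (m + b)) / P ^ b) * g (nat \<bar>i\<bar>) a b" for b
  have "kernel_integral q K f i a = disc_integral q (disc_mult q (\<lambda>j b. K i j a b) f)"
    by (simp add: kernel_integral_def kernel_mult_right_def)
  also have "\<dots> = (1 - P) * (\<Sum>n\<in>S. \<Sum>b<B. K i (- n) a b * f n b * complex_of_real (disc_weight n b))"
    by (rule disc_integral_mult[OF box])
  also have "(\<Sum>n\<in>S. \<Sum>b<B. K i (- n) a b * f n b * complex_of_real (disc_weight n b)) =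
      (\<Sum>n\<in>S. if n = i then (\<Sum>b<B. t b) else 0)"
  proof (intro sum.cong refl)
    fix n
    show "(\<Sum>b<B. K i (- n) a b * f n b * complex_of_real (disc_weight n b)) =
        (if n = i then (\<Sum>b<B. t b) else 0)"
    proof (cases "n = i")
      case True
      have "K i (- i) a b * f i b * complex_of_real (disc_weight i b) = t b" for b
        unfolding t_def w[symmetric] by (simp add: K)
      then show ?thesis using True by simp
    qed (simp add: K)
  qed
  also have "\<dots> = (\<Sum>b<B. t b)"
  proof (cases "i \<in> S")
    case True
    then show ?thesis using box by (simp add: box_supported_def)
  next
    case False
    then have "t b = 0" for b using box by (auto simp: box_supported_def t_def)
    then show ?thesis using box by (simp add: box_supported_def)
  qed
  finally show ?thesis by (simp add: t_def sum_distrib_left mult_ac)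
qed

lemma kernel_integral_disc_L2:
  assumes K: "\<And>i j a b. K i j a b = (if j = - i then degree_factor i * g (nat \<bar>i\<bar>) a b else 0)"
    and g: "\<And>r b. \<exists>C\<ge>0. \<forall>a. norm (g r a b) \<le> C * real (a + b + 1) * p ^ (a - b)"
    and f: "finite_fun f"
  shows "kernel_integral q K f \<in> disc_L2 q"
proof -
  obtain S B where box: "box_supported S B f" using f finite_fun_iff_box by blast
  note eq = kernel_integral_radial[where K = K, OF K box]
  show ?thesis
  proof (rule disc_L2I)
    show "finite S" using box by (simp add: box_supported_def)
    show "kernel_integral q K f n = (\<lambda>_. 0)" if "n \<notin> S" for n
      using that box unfolding fun_eq_iff eq box_supported_def by (auto intro!: sum.neutral)
    fix n
    define c where "c b = (1 - P) * (f n b * ((\<Prod>m=1..nat \<bar>n\<bar>. 1 - P ^ (m + b)) / P ^ b))" for b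
    obtain C where C: "\<And>b. C b \<ge> 0" "\<And>a b. norm (g (nat \<bar>n\<bar>) a b) \<le> C b * real (a + b + 1) * p ^ (a - b)"
      using g[of "nat \<bar>n\<bar>"] by metis
    have gb: "norm (g (nat \<bar>n\<bar>) a b) \<le> C b * real (b + 1) / p ^ b * (real (a + 1) * p ^ a)" for a b
    proof -
      have "real (a + b + 1) \<le> real (b + 1) * real (a + 1)"
        by (simp add: algebra_simps)
      moreover have "p ^ (a - b) \<le> p ^ a / p ^ b"
      proof -
        have "p ^ (a - b) * p ^ b = p ^ (a - b + b)" by (rule power_add[symmetric])
        also have "\<dots> \<le> p ^ a" using p by (intro power_decreasing) auto
        finally show ?thesis using p by (simp add: pos_le_divide_eq)
      qed
      ultimately have "C b * (real (a + b + 1) * p ^ (a - b)) \<le> C b * ((real (b + 1) * real (a + 1)) * (p ^ a / p ^ b))"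
        using C(1) p by (intro mult_left_mono mult_mono) auto
      then show ?thesis using C(2)[of a b] by (simp add: mult_ac)
    qed
    show "summable (\<lambda>j. (norm (kernel_integral q K f n j))\<^sup>2 / p ^ j)"
    proof (rule summable_linear_decay)
      fix a
      have "norm (kernel_integral q K f n a) \<le> (\<Sum>b<B. norm (c b) * (C b * real (b + 1) / p ^ b * (real (a + 1) * p ^ a)))"
        unfolding eq c_def[symmetric]
        by (rule sum_norm_le) (auto simp only: norm_mult intro!: mult_left_mono gb norm_ge_zero)
      then show "norm (kernel_integral q K f n a) \<le>
          (\<Sum>b<B. norm (c b) * (C b * real (b + 1) / p ^ b)) * (real (a + 1) * p ^ a)"
        by (simp only: sum_distrib_right mult.assoc)
    qed
  qed
qed

lemma laplacian_kernel_integral: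
  assumes K: "\<And>i j a b. K i j a b = (if j = - i then degree_factor i * g (nat \<bar>i\<bar>) a b else 0)"
    and box: "box_supported S B f"
  shows "laplacian q (kernel_integral q K f) i a = (\<Sum>b<B.
    ((1 - P) * (f i b * ((\<Prod>m=1..nat \<bar>i\<bar>. 1 - P ^ (m + b)) / P ^ b)))
      * radial P (nat \<bar>i\<bar>) (\<lambda>a. g (nat \<bar>i\<bar>) a b) a)"
proof -
  have "kernel_integral q K f i = (\<lambda>a. \<Sum>b<B.
      ((1 - P) * (f i b * ((\<Prod>m=1..nat \<bar>i\<bar>. 1 - P ^ (m + b)) / P ^ b))) * g (nat \<bar>i\<bar>) a b)"
    by (rule ext) (rule kernel_integral_radial[OF K box])
  then show ?thesis unfolding laplacian_eq by (simp only: radial_sum)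
qed

text \<open>The weight in the integral is the reciprocal of the value of \<open>L\<close> on the Green kernel at \<open>a = b\<close>
  (\<open>radial_green1\<close>).\<close>

lemma laplacian_kernel_integral_green1:
  assumes f: "finite_fun f"
  shows "laplacian q (kernel_integral q (green1 q) f) = f"
proof (intro ext)
  fix i a
  obtain S B where box: "box_supported S B f" using f finite_fun_iff_box by blast
  let ?w = "\<lambda>b. (\<Prod>m=1..nat \<bar>i\<bar>. 1 - P ^ (m + b))"
  have w: "?w b \<noteq> 0" for b
  proof -
    have "1 - P ^ (m + b) \<noteq> 0" if "m \<in> {1..nat \<bar>i\<bar>}" for m
    proof -
      have "p ^ (m + b) \<noteq> 1" using p_power_bounds(3)[of "m + b"] that by auto
      then show ?thesis unfolding P_p by (metis eq_iff_diff_eq_0 of_real_eq_1_iff of_real_power)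
    qed
    then show ?thesis by (simp add: prod_zero_iff)
  qed
  have "laplacian q (kernel_integral q (green1 q) f) i a = (\<Sum>b<B. if a = b then f i b else 0)"
    unfolding laplacian_kernel_integral[where K = "green1 q", OF green1_eq box] radial_green1
    using w P_nz P_ne_1 by (intro sum.cong refl) auto
  also have "\<dots> = f i a"
    using box unfolding box_supported_def by (auto simp: sum.delta)
  finally show "laplacian q (kernel_integral q (green1 q) f) i a = f i a" .
qed

lemma laplacian_kernel_integral_green2:
  assumes f: "finite_fun f"
  shows "laplacian q (kernel_integral q (green2 q) f) = kernel_integral q (green1 q) f"
proof (intro ext)
  fix i a
  obtain S B where box: "box_supported S B f" using f finite_fun_iff_box by blast
  show "laplacian q (kernel_integral q (green2 q) f) i a = kernel_integral q (green1 q) f i a"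
    unfolding laplacian_kernel_integral[where K = "green2 q", OF green2_eq box] radial_green2
      kernel_integral_radial[where K = "green1 q", OF green1_eq box] ..
qed

lemma green_inverse:
  assumes f: "finite_fun f"
  shows "laplacian_inv q f = kernel_integral q (green1 q) f"
    and "(laplacian_inv q ^^ 2) f = kernel_integral q (green2 q) f"
proof -
  have decay: "\<exists>C\<ge>0. \<forall>a. norm (green1_radial r a b) \<le> C * real (a + b + 1) * p ^ (a - b)"
    "\<exists>C\<ge>0. \<forall>a. norm (green2_radial r a b) \<le> C * real (a + b + 1) * p ^ (a - b)" for r b
    using green_radial_decay[of r b] by blast+
  show 1: "laplacian_inv q f = kernel_integral q (green1 q) f"
    by (rule laplacian_inv_eqI[OF kernel_integral_disc_L2[OF green1_eq decay(1) f]
        laplacian_kernel_integral_green1[OF f]])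
  have 2: "laplacian_inv q (kernel_integral q (green1 q) f) = kernel_integral q (green2 q) f"
    by (rule laplacian_inv_eqI[OF kernel_integral_disc_L2[OF green2_eq decay(2) f]
        laplacian_kernel_integral_green2[OF f]])
  show "(laplacian_inv q ^^ 2) f = kernel_integral q (green2 q) f"
    by (simp add: numeral_2_eq_2 1 2)
qed

end

theorem theorem2p2:
  fixes q :: real and f :: disc_series
  assumes "0 < q" and "q < 1" and "finite_fun f"
  shows "kernel_summable (green1_term q) \<and> kernel_summable (green2_term q)
           \<and> kernel_summable (green2_hat_term q)
         \<and> laplacian_inv q f = kernel_integral q (green1 q) f
         \<and> (laplacian_inv q ^^ 2) f = kernel_integral q (green2 q) f"
proof -
  interpret quantum_disc q "q\<^sup>2" "complex_of_real (q\<^sup>2)"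
    by unfold_locales (use assms in auto)
  show ?thesis using kernel_summable_green green_inverse[OF assms(3)] by blast
qed

end
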